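(* Let $\sigma>0$, let $L:[a,b]\times\mathbb{R}^3\to\mathbb{R}$ and $\phi:[a,b]\times\mathbb{R}\to\mathbb{R}$ be differentiable, and let $\varphi:[a-\sigma,a]\to\mathbb{R}$ be a given function. Suppose that $(x,T)$ gives a local minimum on $D_\sigma$ to the functional $$\mathcal{J}(x,T)=\int_a^TL\,{}_\sigma[x]_\gamma^{\alpha,\beta}(t)\,dt+\phi(T,x(T))$$ subject to $x(t)=\varphi(t)$ for all $t\in[a-\sigma,a]$. If $\sigma\ge T-a$, then $(x,T)$ satisfies $$\partial_2L\,{}_\sigma[x]_\gamma^{\alpha,\beta}(t)+D_{\overline\gamma}^{\beta(\cdot,\cdot),\alpha(\cdot,\cdot)}\partial_3L\,{}_\sigma[x]_\gamma^{\alpha,\beta}(t)=0$$ for $t\in[a,T]$, and $$\gamma_2\left({}_aD_t^{\beta(\cdot,\cdot)}\partial_3L\,{}_\sigma[x]_\gamma^{\alpha,\beta}(t)-{}_TD_t^{\beta(\cdot,\cdot)}\partial_3L\,{}_\sigma[x]_\gamma^{\alpha,\beta}(t)\right)=0$$ for $t\in[T,b]$. Moreover, $(x,T)$ satisfies $$ \begin{cases} L\,{}_\sigma[x]_\gamma^{\alpha,\beta}(T)+\partial_1\phi(T,x(T))+\partial_2\phi(T,x(T))x'(T)=0,\\ \left[\gamma_1\,{}_tI_T^{1-\alpha(\cdot,\cdot)}\partial_3L\,{}_\sigma[x]_\gamma^{\alpha,\beta}(t)-\gamma_2\,{}_TI_t^{1-\beta(\cdot,\cdot)}\partial_3L\,{}_\sigma[x]_\gamma^{\alpha,\beta}(t)\right]_{t=T}+\partial_2\phi(T,x(T))=0,\\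 \gamma_2\left[{}_TI_t^{1-\beta(\cdot,\cdot)}\partial_3L\,{}_\sigma[x]_\gamma^{\alpha,\beta}(t)-{}_aI_t^{1-\beta(\cdot,\cdot)}\partial_3L\,{}_\sigma[x]_\gamma^{\alpha,\beta}(t)\right]_{t=b}=0. \end{cases} $$ If $\sigma<T-a$, then the same conclusions hold with the equation $\partial_2L\,{}_\sigma[x]_\gamma^{\alpha,\beta}(t)+D_{\overline\gamma}^{\beta(\cdot,\cdot),\alpha(\cdot,\cdot)}\partial_3L\,{}_\sigma[x]_\gamma^{\alpha,\beta}(t)=0$ for $t\in[a,T]$ replaced by the two following ones: $$\partial_2L\,{}_\sigma[x]_\gamma^{\alpha,\beta}(t)+D_{\overline\gamma}^{\beta(\cdot,\cdot),\alpha(\cdot,\cdot)}\partial_3L\,{}_\sigma[x]_\gamma^{\alpha,\beta}(t)+\partial_4L\,{}_\sigma[x]_\gamma^{\alpha,\beta}(t+\sigma)=0$$ for $t\in[a,T-\sigma]$, and $$\partial_2L\,{}_\sigma[x]_\gamma^{\alpha,\beta}(t)+D_{\overline\gamma}^{\beta(\cdot,\cdot),\alpha(\cdot,\cdot)}\partial_3L\,{}_\sigma[x]_\gamma^{\alpha,\beta}(t)=0$$ for $t\in[T-\sigma,T]$.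
   Context: Let $a<b$ be reals, $\alpha,\beta:[a,b]^2\to(0,1)$ continuous functions, and $\gamma=(\gamma_1,\gamma_2)\in[0,1]^2$ with $\gamma_1,\gamma_2$ not both zero; $\overline\gamma=(\gamma_2,\gamma_1)$. For $c\in[a,b]$ and $\delta\in\{\alpha,\beta\}$ define the variable-order Riemann--Liouville integrals $${}_cI_t^{1-\delta(\cdot,\cdot)}f(t)=\int_c^t\frac{(t-\tau)^{-\delta(t,\tau)}}{\Gamma(1-\delta(t,\tau))}f(\tau)\,d\tau\ (t>c),\qquad {}_tI_c^{1-\delta(\cdot,\cdot)}f(t)=\int_t^c\frac{(\tau-t)^{-\delta(\tau,t)}}{\Gamma(1-\delta(\tau,t))}f(\tau)\,d\tau\ (t<c),$$ the Riemann--Liouville derivatives ${}_cD_t^{\delta(\cdot,\cdot)}f(t)=\frac{d}{dt}\,{}_cI_t^{1-\delta(\cdot,\cdot)}f(t)$ and ${}_tD_c^{\delta(\cdot,\cdot)}f(t)=-\frac{d}{dt}\,{}_tI_c^{1-\delta(\cdot,\cdot)}f(t)$, and the Caputo derivatives ${}_a^CD_t^{\alpha(\cdot,\cdot)}x(t)={}_aI_t^{1-\alpha(\cdot,\cdot)}x'(t)$ and ${}_t^CD_b^{\beta(\cdot,\cdot)}x(t)=-{}_tI_b^{1-\beta(\cdot,\cdot)}x'(t)$. The combined Caputo fractional derivative is ${}^CD_\gamma^{\alpha(\cdot,\cdot),\beta(\cdot,\cdot)}x(t)=\gamma_1\,{}_a^CD_t^{\alpha(\cdot,\cdot)}x(t)+\gamma_2\,{}_t^CD_b^{\beta(\cdot,\cdot)}x(t)$,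 and the dual derivative is $D_{\overline\gamma}^{\beta(\cdot,\cdot),\alpha(\cdot,\cdot)}=\gamma_2\,{}_aD_t^{\beta(\cdot,\cdot)}+\gamma_1\,{}_tD_T^{\alpha(\cdot,\cdot)}$. Notation: ${}_\sigma[x]_\gamma^{\alpha,\beta}(t)=\left(t,x(t),{}^CD_\gamma^{\alpha(\cdot,\cdot),\beta(\cdot,\cdot)}x(t),x(t-\sigma)\right)$; $F\,{}_\sigma[x]_\gamma^{\alpha,\beta}(t)$ means $F$ evaluated at this vector; $\partial_iF$ is the partial derivative with respect to the $i$th argument. $D_\sigma=\{(x,t)\in C^1([a-\sigma,b])\times[a,b]:\ {}^CD_\gamma^{\alpha(\cdot,\cdot),\beta(\cdot,\cdot)}x\in C([a,b])\}$. Local minimum is understood with respect to the norm $\|(x,t)\|=\max_{[a-\sigma,b]}|x|+\max_{[a,b]}|{}^CD_\gamma^{\alpha(\cdot,\cdot),\beta(\cdot,\cdot)}x|+|t|$, among admissible pairs in $D_\sigma$.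
   Formalization: Added: ∂2L, ∂3L, ∂4L are continuous; T > a; the equation on [T,b] and the three end conditions are claimed only for T < b; the differential equations are claimed only at points where at least one of the two separate fractional derivatives exists or a coefficient is zero. *)

theory Defs
  imports "HOL-Analysis.Analysis"
begin

text \<open>
  Functions on an interval or on a product with an interval are total functions of which only
  the values on that set matter; derivatives at the ends of an interval are one-sided.
\<close>

definition C1_on :: "real set \<Rightarrow> (real \<Rightarrow> real) \<Rightarrow> bool" where
  "C1_on S x \<longleftrightarrow>
     (\<exists>x'. (\<forall>t\<in>S. (x has_real_derivative x' t) (at t within S)) \<and> continuous_on S x')"


section \<open>Variable-order fractional operators\<close>

text \<open>
  In the right-sided operator the arguments of the order are interchanged, so that the two
  kernels are adjoint. At \<open>t = c\<close> both integrals are \<open>0\<close>, which is also their limit there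
  when \<open>f\<close> is bounded.
\<close>

definition left_RL_int ::
  "(real \<Rightarrow> real \<Rightarrow> real) \<Rightarrow> real \<Rightarrow> (real \<Rightarrow> real) \<Rightarrow> real \<Rightarrow> real" where
  "left_RL_int \<delta> c f t =
     integral {c..t} (\<lambda>\<tau>. (t - \<tau>) powr (- \<delta> t \<tau>) / Gamma (1 - \<delta> t \<tau>) * f \<tau>)"

definition right_RL_int ::
  "(real \<Rightarrow> real \<Rightarrow> real) \<Rightarrow> real \<Rightarrow> (real \<Rightarrow> real) \<Rightarrow> real \<Rightarrow> real" where
  "right_RL_int \<delta> c f t =
     integral {t..c} (\<lambda>\<tau>. (\<tau> - t) powr (- \<delta> \<tau> t) / Gamma (1 - \<delta> \<tau> t) * f \<tau>)"

text \<open>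
  The derivative is taken relative to an interval \<open>S\<close>, namely the one on which the equation in
  question is posed. The choice matters at its ends: at an instant where a delayed term is
  switched off, the derivatives from the left and from the right differ in general.
\<close>

definition left_RL_deriv ::
  "real set \<Rightarrow> (real \<Rightarrow> real \<Rightarrow> real) \<Rightarrow> real \<Rightarrow> (real \<Rightarrow> real) \<Rightarrow> real \<Rightarrow> real" where
  "left_RL_deriv S \<delta> c f t = vector_derivative (left_RL_int \<delta> c f) (at t within S)"

definition right_RL_deriv ::
  "real set \<Rightarrow> (real \<Rightarrow> real \<Rightarrow> real) \<Rightarrow> real \<Rightarrow> (real \<Rightarrow> real) \<Rightarrow> real \<Rightarrow> real" where
  "right_RL_deriv S \<delta> c f t = - vector_derivative (right_RL_int \<delta> c f) (at t within S)"

definition combined_Caputo ::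
  "real \<Rightarrow> real \<Rightarrow> (real \<Rightarrow> real \<Rightarrow> real) \<Rightarrow> (real \<Rightarrow> real \<Rightarrow> real) \<Rightarrow> real \<Rightarrow> real \<Rightarrow>
   (real \<Rightarrow> real) \<Rightarrow> real \<Rightarrow> real" where
  "combined_Caputo a b \<alpha> \<beta> \<gamma>1 \<gamma>2 x t =
     (let x' = (\<lambda>\<tau>. vector_derivative x (at \<tau> within {a..b}))
      in \<gamma>1 * left_RL_int \<alpha> a x' t + \<gamma>2 * (- right_RL_int \<beta> b x' t))"

definition dual_RL_deriv ::
  "real set \<Rightarrow> real \<Rightarrow> real \<Rightarrow> (real \<Rightarrow> real \<Rightarrow> real) \<Rightarrow> (real \<Rightarrow> real \<Rightarrow> real) \<Rightarrow> real \<Rightarrow> real \<Rightarrow>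
   (real \<Rightarrow> real) \<Rightarrow> real \<Rightarrow> real" where
  "dual_RL_deriv S a T \<beta> \<alpha> \<gamma>2 \<gamma>1 f t =
     \<gamma>2 * left_RL_deriv S \<beta> a f t + \<gamma>1 * right_RL_deriv S \<alpha> T f t"

text \<open>
  An expression \<open>p * f' + q * h'\<close> is meaningful at \<open>t\<close> if every derivative with a nonzero
  coefficient exists (\<open>terms_differentiable\<close>). If only \<open>p * f + q * h\<close> is known to be
  differentiable at \<open>t\<close>, this follows precisely when \<open>sum_splits\<close> holds.
\<close>

definition terms_differentiable ::
  "real \<Rightarrow> (real \<Rightarrow> real) \<Rightarrow> real \<Rightarrow> (real \<Rightarrow> real) \<Rightarrow> real \<Rightarrow> real set \<Rightarrow> bool" where
  "terms_differentiable p f q h t S \<longleftrightarrow>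
     (p \<noteq> 0 \<longrightarrow> f differentiable (at t within S)) \<and>
     (q \<noteq> 0 \<longrightarrow> h differentiable (at t within S))"

definition sum_splits ::
  "real \<Rightarrow> (real \<Rightarrow> real) \<Rightarrow> real \<Rightarrow> (real \<Rightarrow> real) \<Rightarrow> real \<Rightarrow> real set \<Rightarrow> bool" where
  "sum_splits p f q h t S \<longleftrightarrow>
     p = 0 \<or> q = 0 \<or> f differentiable (at t within S) \<or> h differentiable (at t within S)"

lemma terms_differentiable_iff_sum_splits:
  assumes sum: "(\<lambda>s. p * f s + q * h s) differentiable (at t within S)"
  shows "terms_differentiable p f q h t S \<longleftrightarrow> sum_splits p f q h t S"
proof -
  have h: "h differentiable (at t within S)"
    if "q \<noteq> 0" and f: "p = 0 \<or> f differentiable (at t within S)"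
  proof -
    have pf: "(\<lambda>s. p * f s) differentiable (at t within S)"
      using f by (auto intro: derivative_intros)
    have "(\<lambda>s. (1 / q) * ((p * f s + q * h s) - p * f s)) differentiable (at t within S)"
      by (intro differentiable_mult differentiable_const differentiable_diff sum pf)
    moreover have "(\<lambda>s. (1 / q) * ((p * f s + q * h s) - p * f s)) = h"
      using \<open>q \<noteq> 0\<close> by auto
    ultimately show ?thesis by simp
  qed
  have f: "f differentiable (at t within S)"
    if "p \<noteq> 0" and h: "q = 0 \<or> h differentiable (at t within S)"
  proof -
    have qh: "(\<lambda>s. q * h s) differentiable (at t within S)"
      using h by (auto intro: derivative_intros)
    have "(\<lambda>s. (1 / p) * ((p * f s + q * h s) - q * h s)) differentiable (at t within S)"
      by (intro differentiable_mult differentiable_const differentiable_diff sum qh)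
    moreover have "(\<lambda>s. (1 / p) * ((p * f s + q * h s) - q * h s)) = f"
      using \<open>p \<noteq> 0\<close> by auto
    ultimately show ?thesis by simp
  qed
  show ?thesis
    using f h unfolding terms_differentiable_def sum_splits_def by blast
qed


section \<open>Partial derivatives\<close>

definition pd2 :: "(real \<times> real \<times> real \<times> real \<Rightarrow> real) \<Rightarrow> real \<times> real \<times> real \<times> real \<Rightarrow> real" where
  "pd2 L = (\<lambda>(t, u, v, w). deriv (\<lambda>s. L (t, s, v, w)) u)"

definition pd3 :: "(real \<times> real \<times> real \<times> real \<Rightarrow> real) \<Rightarrow> real \<times> real \<times> real \<times> real \<Rightarrow> real" where
  "pd3 L = (\<lambda>(t, u, v, w). deriv (\<lambda>s. L (t, u, s, w)) v)"

definition pd4 :: "(real \<times> real \<times> real \<times> real \<Rightarrow> real) \<Rightarrow> real \<times> real \<times> real \<times> real \<Rightarrow> real" where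
  "pd4 L = (\<lambda>(t, u, v, w). deriv (\<lambda>s. L (t, u, v, s)) w)"

definition cost_pd1 :: "(real \<times> real \<Rightarrow> real) \<Rightarrow> real \<times> real \<Rightarrow> real" where
  "cost_pd1 \<phi> = (\<lambda>(t, u). deriv (\<lambda>s. \<phi> (s, u)) t)"

definition cost_pd2 :: "(real \<times> real \<Rightarrow> real) \<Rightarrow> real \<times> real \<Rightarrow> real" where
  "cost_pd2 \<phi> = (\<lambda>(t, u). deriv (\<lambda>s. \<phi> (t, s)) u)"


section \<open>The variational problem with delay\<close>

definition delay_args ::
  "real \<Rightarrow> real \<Rightarrow> (real \<Rightarrow> real \<Rightarrow> real) \<Rightarrow> (real \<Rightarrow> real \<Rightarrow> real) \<Rightarrow> real \<Rightarrow> real \<Rightarrow> real \<Rightarrow>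
   (real \<Rightarrow> real) \<Rightarrow> real \<Rightarrow> real \<times> real \<times> real \<times> real" where
  "delay_args a b \<alpha> \<beta> \<gamma>1 \<gamma>2 \<sigma> x t =
     (t, x t, combined_Caputo a b \<alpha> \<beta> \<gamma>1 \<gamma>2 x t, x (t - \<sigma>))"

definition delay_space ::
  "real \<Rightarrow> real \<Rightarrow> (real \<Rightarrow> real \<Rightarrow> real) \<Rightarrow> (real \<Rightarrow> real \<Rightarrow> real) \<Rightarrow> real \<Rightarrow> real \<Rightarrow> real \<Rightarrow>
   ((real \<Rightarrow> real) \<times> real) set" where
  "delay_space a b \<alpha> \<beta> \<gamma>1 \<gamma>2 \<sigma> =
     {(x, t). C1_on {a - \<sigma>..b} x \<and> t \<in> {a..b} \<and>
              continuous_on {a..b} (combined_Caputo a b \<alpha> \<beta> \<gamma>1 \<gamma>2 x)}"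

text \<open>On \<open>delay_space\<close> the suprema are maxima of continuous functions on compact intervals.\<close>

definition delay_norm ::
  "real \<Rightarrow> real \<Rightarrow> (real \<Rightarrow> real \<Rightarrow> real) \<Rightarrow> (real \<Rightarrow> real \<Rightarrow> real) \<Rightarrow> real \<Rightarrow> real \<Rightarrow> real \<Rightarrow>
   (real \<Rightarrow> real) \<times> real \<Rightarrow> real" where
  "delay_norm a b \<alpha> \<beta> \<gamma>1 \<gamma>2 \<sigma> = (\<lambda>(x, t).
     (SUP s\<in>{a - \<sigma>..b}. \<bar>x s\<bar>) +
     (SUP s\<in>{a..b}. \<bar>combined_Caputo a b \<alpha> \<beta> \<gamma>1 \<gamma>2 x s\<bar>) + \<bar>t\<bar>)"

definition delay_functional ::
  "real \<Rightarrow> real \<Rightarrow> (real \<Rightarrow> real \<Rightarrow> real) \<Rightarrow> (real \<Rightarrow> real \<Rightarrow> real) \<Rightarrow> real \<Rightarrow> real \<Rightarrow> real \<Rightarrow>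
   (real \<times> real \<times> real \<times> real \<Rightarrow> real) \<Rightarrow> (real \<times> real \<Rightarrow> real) \<Rightarrow> (real \<Rightarrow> real) \<Rightarrow> real \<Rightarrow> real" where
  "delay_functional a b \<alpha> \<beta> \<gamma>1 \<gamma>2 \<sigma> L \<phi> x T =
     integral {a..T} (\<lambda>t. L (delay_args a b \<alpha> \<beta> \<gamma>1 \<gamma>2 \<sigma> x t)) + \<phi> (T, x T)"

definition admissible ::
  "real \<Rightarrow> real \<Rightarrow> (real \<Rightarrow> real \<Rightarrow> real) \<Rightarrow> (real \<Rightarrow> real \<Rightarrow> real) \<Rightarrow> real \<Rightarrow> real \<Rightarrow> real \<Rightarrow>
   (real \<Rightarrow> real) \<Rightarrow> ((real \<Rightarrow> real) \<times> real) set" where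
  "admissible a b \<alpha> \<beta> \<gamma>1 \<gamma>2 \<sigma> \<psi> =
     {(x, t) \<in> delay_space a b \<alpha> \<beta> \<gamma>1 \<gamma>2 \<sigma>. \<forall>s\<in>{a - \<sigma>..a}. x s = \<psi> s}"

definition local_minimum ::
  "real \<Rightarrow> real \<Rightarrow> (real \<Rightarrow> real \<Rightarrow> real) \<Rightarrow> (real \<Rightarrow> real \<Rightarrow> real) \<Rightarrow> real \<Rightarrow> real \<Rightarrow> real \<Rightarrow>
   (real \<times> real \<times> real \<times> real \<Rightarrow> real) \<Rightarrow> (real \<times> real \<Rightarrow> real) \<Rightarrow> (real \<Rightarrow> real) \<Rightarrow>
   (real \<Rightarrow> real) \<Rightarrow> real \<Rightarrow> bool" where
  "local_minimum a b \<alpha> \<beta> \<gamma>1 \<gamma>2 \<sigma> L \<phi> \<psi> x T \<longleftrightarrow>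
     (x, T) \<in> admissible a b \<alpha> \<beta> \<gamma>1 \<gamma>2 \<sigma> \<psi> \<and>
     (\<exists>\<epsilon>>0. \<forall>(y, U)\<in>admissible a b \<alpha> \<beta> \<gamma>1 \<gamma>2 \<sigma> \<psi>.
        delay_norm a b \<alpha> \<beta> \<gamma>1 \<gamma>2 \<sigma> (\<lambda>t. y t - x t, U - T) < \<epsilon> \<longrightarrow>
        delay_functional a b \<alpha> \<beta> \<gamma>1 \<gamma>2 \<sigma> L \<phi> x T \<le> delay_functional a b \<alpha> \<beta> \<gamma>1 \<gamma>2 \<sigma> L \<phi> y U)"

end

theory Submission
  imports Defs
begin

text \<open>
  Perturb \<open>x\<close> by \<open>e * \<eta>\<close>, where \<open>\<eta>\<close> is the primitive of a continuous \<open>h\<close> that vanishes up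
  to \<open>a\<close>; every such perturbation is admissible and small in the norm. Fubini's theorem for the
  weakly singular kernels and integration by parts of the remaining terms turn the vanishing first
  variation into \<open>\<integral>\<^sub>a\<^sup>T R h = \<integral>\<^sub>T\<^sup>b Q h\<close>, where no derivative of a fractional integral occurs:
  \<open>R\<close> and \<open>Q\<close> are continuous combinations of fractional integrals of \<open>\<partial>\<^sub>3L\<close> and of primitives of
  \<open>\<partial>\<^sub>2L\<close> and \<open>\<partial>\<^sub>4L\<close>. Hence \<open>R\<close> and \<open>Q\<close> vanish identically. Differentiating \<open>R = 0\<close> and \<open>Q = 0\<close>
  gives the Euler--Lagrange equations, and their values at \<open>T\<close> and \<open>b\<close> the transversality
  conditions; the remaining condition at \<open>T\<close> comes from varying \<open>T\<close> alone.
\<close>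

section \<open>Integral operators with weakly singular kernels\<close>

text \<open>Lebesgue integrals below run over the whole line, so functions on \<open>{a..b}\<close>
  enter through their extension by 0, which stays bounded and Borel although it may jump at the
  ends.\<close>

lemma continuous_Icc_extend:
  fixes f :: "real \<Rightarrow> real"
  assumes f: "continuous_on {a..b} f"
  obtains B where "\<And>s. \<bar>indicator {a..b} s * f s\<bar> \<le> B"
    and "(\<lambda>s. indicator {a..b} s * f s) \<in> borel_measurable borel"
proof -
  have "bounded (f ` {a..b})"
    using f compact_continuous_image compact_imp_bounded by blast
  then obtain B where "0 < B" "\<And>s. s \<in> {a..b} \<Longrightarrow> \<bar>f s\<bar> \<le> B"
    unfolding bounded_pos by auto
  then have "\<bar>indicator {a..b} s * f s\<bar> \<le> B" for s
    by (auto simp: indicator_def)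
  moreover have "(\<lambda>s. indicator {a..b} s * f s) \<in> borel_measurable borel"
    using borel_measurable_continuous_on_indicator[OF _ f] by simp
  ultimately show ?thesis
    by (rule that)
qed

text \<open>The kernel is set to 0 off the half-open triangle, diagonal included, so that no
  integral has moving limits. \<open>m < 1\<close> makes the singularity at \<open>s = t\<close>
  integrable, uniformly in \<open>t\<close>.\<close>

locale weakly_singular_kernel =
  fixes k :: "real \<Rightarrow> real \<Rightarrow> real" and a b C m :: real
  assumes outside: "\<And>t s. \<not> (a \<le> s \<and> s < t \<and> t \<le> b) \<Longrightarrow> k t s = 0"
    and cont: "continuous_on {(t, s). a \<le> s \<and> s < t \<and> t \<le> b} (\<lambda>(t, s). k t s)"
    and bound: "\<And>t s. a \<le> s \<Longrightarrow> s < t \<Longrightarrow> t \<le> b \<Longrightarrow> \<bar>k t s\<bar> \<le> C * (t - s) powr (- m)"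
    and m: "m < 1"
begin

lemma inside: "a \<le> s \<and> s < t \<and> t \<le> b" if "k t s \<noteq> 0"
  using outside that by blast

text \<open>A bound that depends only on \<open>t - s\<close>: its integral in \<open>s\<close> is
  the same for every \<open>t\<close>, and after the substitution \<open>r = t - s\<close> it no
  longer moves.\<close>

definition majorant :: "real \<Rightarrow> real" where
  "majorant r = indicator {0..b - a} r * (\<bar>C\<bar> * r powr (- m))"

lemma majorant_nonneg: "0 \<le> majorant r"
  by (auto simp: majorant_def)

text \<open>The power is integrable at 0 because \<open>- m > - 1\<close>. Being nonnegative it is
  absolutely integrable, hence Lebesgue integrable, and Borel measurability brings it down from the
  completed measure.\<close>

lemma majorant_integrable: "integrable lborel majorant"
proof -
  have "(\<lambda>r. r powr (- m)) absolutely_integrable_on {0..b - a}"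
  proof (cases "a \<le> b")
    case True
    then have "(\<lambda>r::real. r powr (- m)) integrable_on {0..b - a}"
      using has_integral_powr_from_0[of "- m" "b - a"] m by (auto simp: integrable_on_def)
    then show ?thesis
      by (subst absolutely_integrable_on_iff_nonneg) auto
  qed auto
  then have "integrable lebesgue (\<lambda>r. indicator {0..b - a} r *\<^sub>R r powr (- m))"
    by (simp add: set_integrable_def)
  then have "integrable lborel (\<lambda>r. indicator {0..b - a} r *\<^sub>R r powr (- m))"
    by (subst (asm) integrable_completion) measurable
  then have "integrable lborel (\<lambda>r. \<bar>C\<bar> * (indicator {0..b - a} r *\<^sub>R r powr (- m)))"
    by (rule integrable_mult_right)
  then show ?thesis
    unfolding majorant_def by (simp add: algebra_simps)
qed

lemma majorant_integrable_shift: "integrable lborel (\<lambda>s. majorant (t - s))"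
  using lborel_integrable_real_affine[OF majorant_integrable, of "-1" t] by simp

lemma majorant_integral_shift: "(LINT s|lborel. majorant (t - s)) = (LINT r|lborel. majorant r)"
  using lborel_integral_real_affine[of "-1" majorant t] by simp

lemma k_le_majorant: "\<bar>k t s\<bar> \<le> majorant (t - s)"
proof (cases "a \<le> s \<and> s < t \<and> t \<le> b")
  case True
  then have "\<bar>k t s\<bar> \<le> C * (t - s) powr (- m)"
    using bound by auto
  also have "\<dots> \<le> \<bar>C\<bar> * (t - s) powr (- m)"
    by (intro mult_right_mono) auto
  also have "\<dots> = majorant (t - s)"
    using True by (auto simp: majorant_def)
  finally show ?thesis .
qed (use outside majorant_nonneg in auto)

text \<open>Continuity is given only on the triangle; this is a Borel set, and off it the kernel is
  0.\<close>

lemma k_measurable_pair: "(\<lambda>(t, s). k t s) \<in> borel_measurable (lborel \<Otimes>\<^sub>M lborel)"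
proof -
  let ?A = "{(t, s). a \<le> s \<and> s < t \<and> t \<le> b}"
  have "(\<lambda>p. indicator ?A p *\<^sub>R (case p of (t, s) \<Rightarrow> k t s)) \<in> borel_measurable borel"
  proof (rule borel_measurable_continuous_on_indicator[OF _ cont])
    have "Measurable.pred (borel \<Otimes>\<^sub>M borel) (\<lambda>(t, s). a \<le> s \<and> s < t \<and> t \<le> (b::real))"
      by measurable
    then show "?A \<in> sets borel"
      by (simp add: pred_def borel_prod space_pair_measure)
  qed
  moreover have "(\<lambda>p. indicator ?A p *\<^sub>R (case p of (t, s) \<Rightarrow> k t s)) = (\<lambda>(t, s). k t s)"
    by (auto simp: indicator_def fun_eq_iff dest: inside)
  ultimately show ?thesis
    by (simp add: borel_prod lborel_prod)
qed

lemma k_measurable [measurable]: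
  assumes "f \<in> borel_measurable M" "g \<in> borel_measurable M"
  shows "(\<lambda>x. k (f x) (g x)) \<in> borel_measurable M"
proof -
  have "(\<lambda>x. (f x, g x)) \<in> M \<rightarrow>\<^sub>M lborel \<Otimes>\<^sub>M lborel"
    using assms by measurable
  from measurable_compose[OF this k_measurable_pair] show ?thesis
    by simp
qed

section \<open>Integrability against bounded functions and Fubini's theorem\<close>

lemma k_integrable:
  assumes [measurable]: "f \<in> borel_measurable borel" and f: "\<And>s. \<bar>f s\<bar> \<le> B"
  shows "integrable lborel (\<lambda>s. k t s * f s)"
proof (rule Bochner_Integration.integrable_bound)
  show "integrable lborel (\<lambda>s. majorant (t - s) * B)"
    using majorant_integrable_shift by simp
  have "\<bar>k t s * f s\<bar> \<le> \<bar>majorant (t - s) * B\<bar>" for s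
    unfolding abs_mult using k_le_majorant[of t s] f[of s] majorant_nonneg[of "t - s"]
    by (intro mult_mono) auto
  then show "AE s in lborel. norm (k t s * f s) \<le> norm (majorant (t - s) * B)"
    by simp
qed measurable

lemma k_integrable_right:
  assumes [measurable]: "f \<in> borel_measurable borel" and f: "\<And>s. \<bar>f s\<bar> \<le> B"
  shows "integrable lborel (\<lambda>s. k s t * f s)"
proof (rule Bochner_Integration.integrable_bound)
  show "integrable lborel (\<lambda>s. majorant (s - t) * B)"
    using lborel_integrable_real_affine[OF majorant_integrable, of 1 "- t"] by simp
  have "\<bar>k s t * f s\<bar> \<le> \<bar>majorant (s - t) * B\<bar>" for s
    unfolding abs_mult using k_le_majorant[of s t] f[of s] majorant_nonneg[of "s - t"]
    by (intro mult_mono) auto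
  then show "AE s in lborel. norm (k s t * f s) \<le> norm (majorant (s - t) * B)"
    by simp
qed measurable

text \<open>Integrating the absolute kernel first in \<open>s\<close> leaves a bound that does not
  depend on \<open>t\<close>, so the double integral converges absolutely and the order may be
  exchanged.\<close>

lemma Fubini_kernel:
  assumes [measurable]: "f \<in> borel_measurable borel" "g \<in> borel_measurable borel"
    and f: "\<And>s. \<bar>f s\<bar> \<le> B" and g: "\<And>s. \<bar>g s\<bar> \<le> B"
  shows "(LINT t|lborel. g t * (LINT s|lborel. k t s * f s)) =
         (LINT s|lborel. f s * (LINT t|lborel. k t s * g t))"
    and "integrable lborel (\<lambda>t. g t * (LINT s|lborel. k t s * f s))"
proof -
  have B: "0 \<le> B"
    using f[of 0] by linarith
  let ?H = "\<lambda>t s. g t * (k t s * f s)"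
  \<comment> \<open>The indicator of \<open>t\<close> comes from the support of \<open>k\<close>.
    The majorant integrated in \<open>s\<close> is a constant in \<open>t\<close>, which this
    indicator makes integrable over the line.\<close>
  have le: "norm (?H t s) \<le> indicator {a..b} t * (B * B * majorant (t - s))" for t s
  proof (cases "k t s = 0")
    case False
    then have "t \<in> {a..b}"
      using inside[of t s] by auto
    moreover have "\<bar>g t\<bar> * (\<bar>k t s\<bar> * \<bar>f s\<bar>) \<le> B * (majorant (t - s) * B)"
      using k_le_majorant[of t s] f[of s] g[of t] majorant_nonneg[of "t - s"] B by (intro mult_mono) auto
    ultimately show ?thesis
      by (simp add: abs_mult mult_ac)
  qed (use majorant_nonneg B in auto)
  have H: "integrable lborel (\<lambda>s. ?H t s)" for t
    using k_integrable[of f B t] f by simp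
  have int: "integrable (lborel \<Otimes>\<^sub>M lborel) (\<lambda>(t, s). ?H t s)"
  proof (rule lborel_pair.Fubini_integrable)
    show "integrable lborel (\<lambda>t. LINT s|lborel. norm (case (t, s) of (t, s) \<Rightarrow> ?H t s))"
    proof (rule Bochner_Integration.integrable_bound)
      show "integrable lborel (\<lambda>t. indicator {a..b} t * (B * B * (LINT r|lborel. majorant r)))"
        by (intro integrable_mult_left) (simp add: integrable_indicator_iff emeasure_lborel_Icc_eq)
      show "AE t in lborel. norm (LINT s|lborel. norm (case (t, s) of (t, s) \<Rightarrow> ?H t s))
              \<le> norm (indicator {a..b} t * (B * B * (LINT r|lborel. majorant r)))"
      proof (rule AE_I2)
        fix t
        have "(LINT s|lborel. norm (?H t s)) \<le>
              (LINT s|lborel. indicator {a..b} t * (B * B * majorant (t - s)))"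
          using H[of t] majorant_integrable_shift[of t] le
          by (intro integral_mono) (auto intro: integrable_norm)
        also have "\<dots> = indicator {a..b} t * (B * B * (LINT r|lborel. majorant r))"
          by (simp add: majorant_integral_shift)
        finally show "norm (LINT s|lborel. norm (case (t, s) of (t, s) \<Rightarrow> ?H t s))
              \<le> norm (indicator {a..b} t * (B * B * (LINT r|lborel. majorant r)))"
          by (simp add: Bochner_Integration.integral_nonneg_AE)
      qed
    qed measurable
  qed (use H in auto)
  have "(LINT s|lborel. (LINT t|lborel. ?H t s)) = (LINT t|lborel. (LINT s|lborel. ?H t s))"
    using int by (rule lborel_pair.Fubini_integral)
  moreover have "(\<lambda>t. ?H t s) = (\<lambda>t. f s * (k t s * g t))" for s
    by (auto simp: fun_eq_iff)
  ultimately show "(LINT t|lborel. g t * (LINT s|lborel. k t s * f s)) =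
         (LINT s|lborel. f s * (LINT t|lborel. k t s * g t))"
    by simp
  show "integrable lborel (\<lambda>t. g t * (LINT s|lborel. k t s * f s))"
    using lborel_pair.integrable_fst[OF int] by simp
qed

text \<open>Sending \<open>(t, s)\<close> to \<open>(- s, - t)\<close> preserves
  \<open>t - s\<close> and the shape of the triangle while exchanging the roles of the variables, so
  right-sided operators become left-sided ones.\<close>

lemma reflected: "weakly_singular_kernel (\<lambda>t s. k (- s) (- t)) (- b) (- a) C m"
proof
  show "continuous_on {(t, s). - b \<le> s \<and> s < t \<and> t \<le> - a} (\<lambda>(t, s). k (- s) (- t))"
    using continuous_on_compose2[OF cont, of "{(t, s). - b \<le> s \<and> s < t \<and> t \<le> - a}"
        "\<lambda>p. (- snd p, - fst p)"]
    by (force simp: split_beta intro!: continuous_intros)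
next
  fix t s assume "- b \<le> s" "s < t" "t \<le> - a"
  then show "\<bar>k (- s) (- t)\<bar> \<le> C * (t - s) powr (- m)"
    using bound[of "- t" "- s"] by auto
qed (use outside m in auto)

text \<open>
  Substituting \<open>s = t - r\<close> moves the singularity to the fixed point \<open>r = 0\<close>, where \<open>majorant\<close> dominates it.
\<close>

lemma continuous_left:
  assumes f: "continuous_on {a..b} f"
  shows "continuous_on {a..b} (\<lambda>t. LINT s|lborel. k t s * f s)"
  unfolding continuous_on_sequentially
proof safe
  fix u :: "nat \<Rightarrow> real" and t0
  assume t0: "t0 \<in> {a..b}" and u: "\<forall>n. u n \<in> {a..b}" and lim: "u \<longlonglongrightarrow> t0"
  define f' where "f' = (\<lambda>s. indicator {a..b} s * f s)"
  obtain B where f'B: "\<And>s. \<bar>f' s\<bar> \<le> B" and [measurable]: "f' \<in> borel_measurable borel"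
    unfolding f'_def using continuous_Icc_extend[OF f] by blast
  have kf': "k t s * f s = k t s * f' s" for t s
    using outside[of s t] by (cases "a \<le> s \<and> s < t \<and> t \<le> b") (auto simp: f'_def)
  have eq: "(LINT s|lborel. k t s * f s) = (LINT r|lborel. k t (t - r) * f' (t - r))" for t
    using lborel_integral_real_affine[of "-1" "\<lambda>s. k t s * f' s" t] by (simp add: kf')
  have "(\<lambda>n. LINT r|lborel. k (u n) (u n - r) * f' (u n - r))
          \<longlonglongrightarrow> (LINT r|lborel. k t0 (t0 - r) * f' (t0 - r))"
  proof (rule integral_dominated_convergence)
    show "integrable lborel (\<lambda>r. majorant r * B)"
      using majorant_integrable by simp
    show "AE r in lborel. norm (k (u n) (u n - r) * f' (u n - r)) \<le> majorant r * B" for n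
    proof (rule AE_I2)
      fix r
      show "norm (k (u n) (u n - r) * f' (u n - r)) \<le> majorant r * B"
        unfolding real_norm_def abs_mult
        using k_le_majorant[of "u n" "u n - r"] f'B[of "u n - r"] majorant_nonneg[of r]
        by (intro mult_mono) auto
    qed
    \<comment> \<open>Excluded are the singularity \<open>r = 0\<close> and
      \<open>r = t0 - a\<close>, where \<open>u n - r\<close> may lie on either side of
      \<open>a\<close> and the kernel may jump. Elsewhere the point is eventually off the triangle
      or in it, where \<open>k\<close> is continuous.\<close>
    have "AE r in lborel. r \<noteq> 0 \<and> r \<noteq> t0 - a"
      by (intro AE_conjI AE_lborel_singleton)
    then show "AE r in lborel. (\<lambda>n. k (u n) (u n - r) * f' (u n - r))
        \<longlonglongrightarrow> k t0 (t0 - r) * f' (t0 - r)"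
    proof eventually_elim
      case (elim r)
      let ?A = "{(t, s). a \<le> s \<and> s < t \<and> t \<le> b}"
      have ur: "(\<lambda>n. u n - r) \<longlonglongrightarrow> t0 - r"
        by (intro tendsto_intros lim)
      consider "r < 0" | "r > t0 - a" | "0 < r" "r < t0 - a"
        using elim by linarith
      then show ?case
      proof cases
        case 1
        then show ?thesis
          using outside by auto
      next
        case 2
        then have "\<forall>\<^sub>F n in sequentially. u n - r < a"
          using order_tendstoD(2)[OF ur, of a] by auto
        then have "\<forall>\<^sub>F n in sequentially. k (u n) (u n - r) * f' (u n - r) = 0"
          by eventually_elim (use outside in auto)
        moreover have "k t0 (t0 - r) = 0"
          using 2 outside by auto
        ultimately show ?thesis
          by (simp add: tendsto_eventually)
      next
        case 3
        then have *: "\<forall>\<^sub>F n in sequentially. a < u n - r"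
          using order_tendstoD(1)[OF ur, of a] by auto
        have "(\<lambda>n. case (u n, u n - r) of (t, s) \<Rightarrow> k t s)
                \<longlonglongrightarrow> (case (t0, t0 - r) of (t, s) \<Rightarrow> k t s)"
        proof (rule continuous_on_tendsto_compose[OF cont])
          show "(\<lambda>n. (u n, u n - r)) \<longlonglongrightarrow> (t0, t0 - r)"
            by (intro tendsto_intros lim)
          show "\<forall>\<^sub>F n in sequentially. (u n, u n - r) \<in> ?A"
            using * by eventually_elim (use u 3 in auto)
        qed (use 3 t0 in auto)
        moreover have "(\<lambda>n. f (u n - r)) \<longlonglongrightarrow> f (t0 - r)"
        proof (rule continuous_on_tendsto_compose[OF f ur])
          show "\<forall>\<^sub>F n in sequentially. u n - r \<in> {a..b}"
            using * by eventually_elim (use u 3 in \<open>auto simp: field_simps intro: order_trans\<close>)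
        qed (use 3 t0 in auto)
        ultimately show ?thesis
          unfolding kf'[symmetric] by (auto intro: tendsto_mult)
      qed
    qed
  qed measurable
  then show "((\<lambda>t. LINT s|lborel. k t s * f s) \<circ> u) \<longlonglongrightarrow> (LINT s|lborel. k t0 s * f s)"
    by (simp add: eq o_def)
qed

lemma continuous_right:
  assumes f: "continuous_on {a..b} f"
  shows "continuous_on {a..b} (\<lambda>t. LINT s|lborel. k s t * f s)"
proof -
  interpret r: weakly_singular_kernel "\<lambda>t s. k (- s) (- t)" "- b" "- a" C m
    by (rule reflected)
  have "continuous_on {- b..- a} (\<lambda>t. LINT s|lborel. k (- s) (- t) * f (- s))"
    by (intro r.continuous_left continuous_on_compose2[OF f]) (auto intro!: continuous_intros)
  then have "continuous_on {a..b} (\<lambda>t. LINT s|lborel. k (- s) (- (- t)) * f (- s))"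
    by (rule continuous_on_compose2) (auto intro!: continuous_intros)
  moreover have "(LINT s|lborel. k s t * f s) = (LINT s|lborel. k (- s) t * f (- s))" for t
    using lborel_integral_real_affine[of "-1" "\<lambda>s. k s t * f s" 0] by simp
  ultimately show ?thesis
    by simp
qed

end

section \<open>Riemann--Liouville integrals of variable order\<close>

text \<open>Passage from Lebesgue integrals over the line to the gauge integral over an interval, in
  terms of which the operators are defined.\<close>

lemma lborel_integral_Icc:
  fixes f :: "real \<Rightarrow> real"
  assumes "integrable lborel (\<lambda>s. indicator {a..b} s * f s)"
  shows "integral {a..b} f = (LINT s|lborel. indicator {a..b} s * f s)"
    and "f integrable_on {a..b}"
  using set_borel_integral_eq_integral[of "{a..b}" f] assms
  by (simp_all add: set_integrable_def set_lebesgue_integral_def)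

text \<open>One kernel serves both operators: integration in \<open>s\<close> gives the left one, in
  \<open>t\<close> the right one. Their adjointness then is Fubini's theorem.\<close>

definition RL_kernel :: "real \<Rightarrow> real \<Rightarrow> (real \<Rightarrow> real \<Rightarrow> real) \<Rightarrow> real \<Rightarrow> real \<Rightarrow> real" where
  "RL_kernel a b \<delta> t s =
     (if a \<le> s \<and> s < t \<and> t \<le> b then (t - s) powr (- \<delta> t s) / Gamma (1 - \<delta> t s) else 0)"

locale variable_order =
  fixes a b :: real and \<delta> :: "real \<Rightarrow> real \<Rightarrow> real"
  assumes ab: "a \<le> b"
    and order_cont: "continuous_on ({a..b} \<times> {a..b}) (\<lambda>(t, s). \<delta> t s)"
    and order_range: "\<And>t s. t \<in> {a..b} \<Longrightarrow> s \<in> {a..b} \<Longrightarrow> \<delta> t s \<in> {0<..<1}"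
begin

section \<open>Kernels of variable order are weakly singular\<close>

lemma subinterval: "variable_order c d \<delta>" if "a \<le> c" "c \<le> d" "d \<le> b"
proof
  show "continuous_on ({c..d} \<times> {c..d}) (\<lambda>(t, s). \<delta> t s)"
    by (rule continuous_on_subset[OF order_cont]) (use that in auto)
qed (use that order_range in auto)

text \<open>By compactness the order has a maximum \<open>m < 1\<close> on the square, which serves
  as one exponent for all points. \<open>rGamma\<close>, the reciprocal of \<open>Gamma\<close>, is
  continuous everywhere and hence bounded along the order.\<close>

lemma kernel: "\<exists>C m. weakly_singular_kernel (RL_kernel a b \<delta>) a b C m"
proof -
  let ?Q = "{a..b} \<times> {a..b}" and ?A = "{(t, s). a \<le> s \<and> s < t \<and> t \<le> b}"
  have Q: "compact ?Q" "?Q \<noteq> {}"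
    using ab by (auto intro: compact_Times)
  obtain p where p: "p \<in> ?Q" "\<And>q. q \<in> ?Q \<Longrightarrow> (case q of (t, s) \<Rightarrow> \<delta> t s) \<le> (case p of (t, s) \<Rightarrow> \<delta> t s)"
    using continuous_attains_sup[OF Q order_cont] by auto
  define m where "m = (case p of (t, s) \<Rightarrow> \<delta> t s)"
  have m: "0 < m" "m < 1" and le_m: "\<And>t s. t \<in> {a..b} \<Longrightarrow> s \<in> {a..b} \<Longrightarrow> \<delta> t s \<le> m"
    using p order_range by (auto simp: m_def split: prod.splits)
  have cont_rG: "continuous_on ?Q (\<lambda>q. rGamma (1 - (case q of (t, s) \<Rightarrow> \<delta> t s)))"
    by (intro continuous_on_compose2[OF continuous_on_rGamma[of UNIV]] continuous_intros order_cont) auto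
  have "bounded ((\<lambda>q. rGamma (1 - (case q of (t, s) \<Rightarrow> \<delta> t s))) ` ?Q)"
    using cont_rG Q(1) compact_continuous_image compact_imp_bounded by blast
  then obtain R where R: "0 < R" "\<And>t s. t \<in> {a..b} \<Longrightarrow> s \<in> {a..b} \<Longrightarrow> \<bar>rGamma (1 - \<delta> t s)\<bar> \<le> R"
    unfolding bounded_pos by auto
  \<comment> \<open>Replacing the exponent \<open>\<delta> t s\<close> by \<open>m\<close> costs a
    factor \<open>(t - s) powr (m - \<delta> t s)\<close> whose exponent lies between 0 and 1; as
    the base is at most \<open>b - a\<close>, the factor is at most \<open>D\<close>.\<close>
  define D where "D = max 1 (b - a)"
  have k_eq: "RL_kernel a b \<delta> t s = (t - s) powr (- \<delta> t s) * rGamma (1 - \<delta> t s)"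
    if "(t, s) \<in> ?A" for t s
    using that by (simp add: RL_kernel_def rGamma_inverse_Gamma field_simps)
  have "weakly_singular_kernel (RL_kernel a b \<delta>) a b (D * R) m"
  proof
    show "RL_kernel a b \<delta> t s = 0" if "\<not> (a \<le> s \<and> s < t \<and> t \<le> b)" for t s
      using that unfolding RL_kernel_def by (rule if_not_P)
    have "continuous_on ?A (\<lambda>q. (fst q - snd q) powr (- (case q of (t, s) \<Rightarrow> \<delta> t s))
            * rGamma (1 - (case q of (t, s) \<Rightarrow> \<delta> t s)))"
    proof (intro continuous_on_mult continuous_on_powr continuous_intros)
      show "continuous_on ?A (\<lambda>(t, s). \<delta> t s)"
        by (rule continuous_on_subset[OF order_cont]) auto
      show "continuous_on ?A (\<lambda>q. rGamma (1 - (case q of (t, s) \<Rightarrow> \<delta> t s)))"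
        by (rule continuous_on_subset[OF cont_rG]) auto
    qed auto
    then show "continuous_on ?A (\<lambda>(t, s). RL_kernel a b \<delta> t s)"
      by (rule continuous_on_eq) (auto simp: k_eq)
    show "\<bar>RL_kernel a b \<delta> t s\<bar> \<le> D * R * (t - s) powr (- m)"
      if "a \<le> s" "s < t" "t \<le> b" for t s
    proof -
      have ts: "t \<in> {a..b}" "s \<in> {a..b}"
        using that by auto
      have "(t - s) powr (m - \<delta> t s) \<le> D powr (m - \<delta> t s)"
        using that le_m[OF ts] by (intro powr_mono2) (auto simp: D_def)
      also have "\<dots> \<le> D powr 1"
        using m order_range[OF ts] by (intro powr_mono) (auto simp: D_def)
      finally have D: "(t - s) powr (m - \<delta> t s) \<le> D"
        by (simp add: D_def)
      have "(t - s) powr (- \<delta> t s) = (t - s) powr (m - \<delta> t s) * (t - s) powr (- m)"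
        by (simp add: powr_add[symmetric])
      also have "\<dots> \<le> D * (t - s) powr (- m)"
        using D by (intro mult_right_mono) auto
      finally have "(t - s) powr (- \<delta> t s) * \<bar>rGamma (1 - \<delta> t s)\<bar> \<le> D * (t - s) powr (- m) * R"
        using R ts by (intro mult_mono) (auto simp: D_def)
      then show ?thesis
        using that k_eq[of t s] by (simp add: abs_mult mult_ac)
    qed
  qed (use m in auto)
  then show ?thesis by blast
qed

lemma left_RL_int_kernel:
  assumes f: "continuous_on {a..b} f" and t: "t \<le> b"
  shows "left_RL_int \<delta> a f t = (LINT s|lborel. RL_kernel a b \<delta> t s * f s)"
    and "(\<lambda>s. (t - s) powr (- \<delta> t s) / Gamma (1 - \<delta> t s) * f s) integrable_on {a..t}"
proof -
  obtain C m where "weakly_singular_kernel (RL_kernel a b \<delta>) a b C m"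
    using kernel by blast
  then interpret weakly_singular_kernel "RL_kernel a b \<delta>" a b C m .
  obtain B where B: "\<And>s. \<bar>indicator {a..b} s * f s\<bar> \<le> B"
    and meas: "(\<lambda>s. indicator {a..b} s * f s) \<in> borel_measurable borel"
    using continuous_Icc_extend[OF f] by blast
  \<comment> \<open>At \<open>s = t\<close> both sides vanish, since \<open>0 powr r = 0\<close>;
    the closed endpoint thus agrees with the kernel being 0 on the diagonal.\<close>
  have eq: "indicator {a..t} s * ((t - s) powr (- \<delta> t s) / Gamma (1 - \<delta> t s) * f s)
      = RL_kernel a b \<delta> t s * (indicator {a..b} s * f s)"
    and eq': "RL_kernel a b \<delta> t s * (indicator {a..b} s * f s) = RL_kernel a b \<delta> t s * f s" for s
    using t by (auto simp: RL_kernel_def indicator_def)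
  have "integrable lborel (\<lambda>s. indicator {a..t} s * ((t - s) powr (- \<delta> t s) / Gamma (1 - \<delta> t s) * f s))"
    unfolding eq using k_integrable[OF meas B] .
  note lborel_integral_Icc[OF this, unfolded eq eq']
  then show "left_RL_int \<delta> a f t = (LINT s|lborel. RL_kernel a b \<delta> t s * f s)"
    and "(\<lambda>s. (t - s) powr (- \<delta> t s) / Gamma (1 - \<delta> t s) * f s) integrable_on {a..t}"
    by (simp_all add: left_RL_int_def)
qed

lemma right_RL_int_kernel:
  assumes f: "continuous_on {a..b} f" and t: "a \<le> t"
  shows "right_RL_int \<delta> b f t = (LINT s|lborel. RL_kernel a b \<delta> s t * f s)"
    and "(\<lambda>s. (s - t) powr (- \<delta> s t) / Gamma (1 - \<delta> s t) * f s) integrable_on {t..b}"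
proof -
  obtain C m where "weakly_singular_kernel (RL_kernel a b \<delta>) a b C m"
    using kernel by blast
  then interpret weakly_singular_kernel "RL_kernel a b \<delta>" a b C m .
  obtain B where B: "\<And>s. \<bar>indicator {a..b} s * f s\<bar> \<le> B"
    and meas: "(\<lambda>s. indicator {a..b} s * f s) \<in> borel_measurable borel"
    using continuous_Icc_extend[OF f] by blast
  have eq: "indicator {t..b} s * ((s - t) powr (- \<delta> s t) / Gamma (1 - \<delta> s t) * f s)
      = RL_kernel a b \<delta> s t * (indicator {a..b} s * f s)"
    and eq': "RL_kernel a b \<delta> s t * (indicator {a..b} s * f s) = RL_kernel a b \<delta> s t * f s" for s
    using t by (auto simp: RL_kernel_def indicator_def)
  have "integrable lborel (\<lambda>s. indicator {t..b} s * ((s - t) powr (- \<delta> s t) / Gamma (1 - \<delta> s t) * f s))"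
    unfolding eq using k_integrable_right[OF meas B] .
  note lborel_integral_Icc[OF this, unfolded eq eq']
  then show "right_RL_int \<delta> b f t = (LINT s|lborel. RL_kernel a b \<delta> s t * f s)"
    and "(\<lambda>s. (s - t) powr (- \<delta> s t) / Gamma (1 - \<delta> s t) * f s) integrable_on {t..b}"
    by (simp_all add: right_RL_int_def)
qed

lemma continuous_left_RL_int:
  assumes f: "continuous_on {a..b} f"
  shows "continuous_on {a..b} (left_RL_int \<delta> a f)"
proof -
  obtain C m where k: "weakly_singular_kernel (RL_kernel a b \<delta>) a b C m"
    using kernel by blast
  show ?thesis
    by (rule continuous_on_eq[OF weakly_singular_kernel.continuous_left[OF k f]])
       (simp add: left_RL_int_kernel[OF f])
qed

lemma continuous_right_RL_int:
  assumes f: "continuous_on {a..b} f"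
  shows "continuous_on {a..b} (right_RL_int \<delta> b f)"
proof -
  obtain C m where k: "weakly_singular_kernel (RL_kernel a b \<delta>) a b C m"
    using kernel by blast
  show ?thesis
    by (rule continuous_on_eq[OF weakly_singular_kernel.continuous_right[OF k f]])
       (simp add: right_RL_int_kernel[OF f])
qed

section \<open>Linearity and adjointness of the fractional integrals\<close>

lemma left_RL_int_linear:
  assumes "continuous_on {a..b} f" "continuous_on {a..b} g" "t \<le> b"
  shows "left_RL_int \<delta> a (\<lambda>s. f s + e * g s) t = left_RL_int \<delta> a f t + e * left_RL_int \<delta> a g t"
proof -
  let ?K = "\<lambda>s. (t - s) powr (- \<delta> t s) / Gamma (1 - \<delta> t s)"
  have "(\<lambda>s. ?K s * (f s + e * g s)) = (\<lambda>s. ?K s * f s + e * (?K s * g s))"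
    by (rule ext) (simp only: distrib_left mult.left_commute)
  moreover have "(\<lambda>s. e * (?K s * g s)) integrable_on {a..t}"
    using left_RL_int_kernel(2)[OF assms(2,3)] by (rule integrable_on_cmult_left[where 'b = real, simplified])
  ultimately show ?thesis
    unfolding left_RL_int_def
    using integral_add[OF left_RL_int_kernel(2)[OF assms(1,3)], of "\<lambda>s. e * (?K s * g s)"]
    by (simp only: integral_mult_right)
qed

lemma right_RL_int_linear:
  assumes "continuous_on {a..b} f" "continuous_on {a..b} g" "a \<le> t"
  shows "right_RL_int \<delta> b (\<lambda>s. f s + e * g s) t = right_RL_int \<delta> b f t + e * right_RL_int \<delta> b g t"
proof -
  let ?K = "\<lambda>s. (s - t) powr (- \<delta> s t) / Gamma (1 - \<delta> s t)"
  have "(\<lambda>s. ?K s * (f s + e * g s)) = (\<lambda>s. ?K s * f s + e * (?K s * g s))"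
    by (rule ext) (simp only: distrib_left mult.left_commute)
  moreover have "(\<lambda>s. e * (?K s * g s)) integrable_on {t..b}"
    using right_RL_int_kernel(2)[OF assms(2,3)] by (rule integrable_on_cmult_left[where 'b = real, simplified])
  ultimately show ?thesis
    unfolding right_RL_int_def
    using integral_add[OF right_RL_int_kernel(2)[OF assms(1,3)], of "\<lambda>s. e * (?K s * g s)"]
    by (simp only: integral_mult_right)
qed

text \<open>Fubini's theorem on the triangle: the arguments of the order are interchanged in the
  right operator, so that both sides integrate the same kernel.\<close>

lemma fractional_integration_by_parts:
  assumes f: "continuous_on {a..b} f" and g: "continuous_on {a..b} g"
  shows "integral {a..b} (\<lambda>t. g t * left_RL_int \<delta> a f t) =
         integral {a..b} (\<lambda>s. f s * right_RL_int \<delta> b g s)"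
proof -
  obtain C m where "weakly_singular_kernel (RL_kernel a b \<delta>) a b C m"
    using kernel by blast
  then interpret weakly_singular_kernel "RL_kernel a b \<delta>" a b C m .
  let ?k = "RL_kernel a b \<delta>"
  define f' g' where "f' = (\<lambda>s. indicator {a..b} s * f s)" and "g' = (\<lambda>s. indicator {a..b} s * g s)"
  obtain B1 where B1: "\<And>s. \<bar>f' s\<bar> \<le> B1" and m1: "f' \<in> borel_measurable borel"
    unfolding f'_def using continuous_Icc_extend[OF f] by blast
  obtain B2 where B2: "\<And>s. \<bar>g' s\<bar> \<le> B2" and m2: "g' \<in> borel_measurable borel"
    unfolding g'_def using continuous_Icc_extend[OF g] by blast
  have k1: "?k t s * f' s = ?k t s * f s" and k2: "?k t s * g' t = ?k t s * g t" for t s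
    by (auto simp: RL_kernel_def f'_def g'_def)
  have "(LINT t|lborel. g' t * (LINT s|lborel. ?k t s * f' s)) =
        (LINT s|lborel. f' s * (LINT t|lborel. ?k t s * g' t))"
    and int: "integrable lborel (\<lambda>t. g' t * (LINT s|lborel. ?k t s * f' s))"
    by (rule Fubini_kernel[OF m1 m2, where B = "max B1 B2"], use B1 B2 in \<open>auto simp: le_max_iff_disj\<close>)+
  moreover have g': "g' t * (LINT s|lborel. ?k t s * f' s) = indicator {a..b} t * (g t * left_RL_int \<delta> a f t)" for t
    by (auto simp: k1 g'_def left_RL_int_kernel[OF f] indicator_def)
  moreover have f': "f' s * (LINT t|lborel. ?k t s * g' t) = indicator {a..b} s * (f s * right_RL_int \<delta> b g s)" for s
    by (auto simp: k2 f'_def right_RL_int_kernel[OF g] indicator_def)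
  moreover have "integrable lborel (\<lambda>s. indicator {a..b} s * (f s * right_RL_int \<delta> b g s))"
    using borel_integrable_atLeastAtMost'[OF continuous_on_mult[OF f continuous_right_RL_int[OF g]]]
    by (simp add: set_integrable_def)
  ultimately show ?thesis
    by (simp add: lborel_integral_Icc)
qed

end

section \<open>The first variation\<close>

lemma left_RL_int_cong:
  "left_RL_int \<delta> c f t = left_RL_int \<delta> c g t" if "\<And>s. s \<in> {c..t} \<Longrightarrow> f s = g s"
  unfolding left_RL_int_def by (rule integral_cong) (simp add: that)

lemma right_RL_int_cong:
  "right_RL_int \<delta> c f t = right_RL_int \<delta> c g t" if "\<And>s. s \<in> {t..c} \<Longrightarrow> f s = g s"
  unfolding right_RL_int_def by (rule integral_cong) (simp add: that)

text \<open>\<open>\<eta>\<close> is free at \<open>d\<close>, so the primitive of \<open>p\<close>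
  is taken as the tail integral, which vanishes there; with \<open>\<eta> c = 0\<close> no boundary
  term is left.\<close>

lemma integral_primitive_by_parts:
  fixes p h \<eta> :: "real \<Rightarrow> real"
  assumes "c \<le> d" and p: "continuous_on {c..d} p" and h: "continuous_on {c..d} h"
    and \<eta>: "\<And>t. t \<in> {c..d} \<Longrightarrow> (\<eta> has_real_derivative h t) (at t within {c..d})" and "\<eta> c = 0"
  shows "integral {c..d} (\<lambda>t. p t * \<eta> t) = integral {c..d} (\<lambda>t. integral {t..d} p * h t)"
proof -
  let ?P = "\<lambda>t. integral {t..d} p"
  have P: "(?P has_real_derivative - p t) (at t within {c..d})" if "t \<in> {c..d}" for t
    using integral_has_real_derivative'[OF p that] .
  have \<eta>_cont: "continuous_on {c..d} \<eta>"
    by (rule DERIV_continuous_on) (rule \<eta>)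
  have P_cont: "continuous_on {c..d} ?P"
    by (rule DERIV_continuous_on) (rule P)
  have "((\<lambda>t. ?P t * h t - p t * \<eta> t) has_integral (?P d * \<eta> d - ?P c * \<eta> c)) {c..d}"
  proof (rule fundamental_theorem_of_calculus[OF \<open>c \<le> d\<close>])
    fix t assume t: "t \<in> {c..d}"
    show "((\<lambda>t. ?P t * \<eta> t) has_vector_derivative ?P t * h t - p t * \<eta> t) (at t within {c..d})"
      unfolding has_real_derivative_iff_has_vector_derivative[symmetric]
      by (auto intro!: derivative_eq_intros P[OF t] \<eta>[OF t])
  qed
  then have "integral {c..d} (\<lambda>t. ?P t * h t - p t * \<eta> t) = 0"
    using \<open>\<eta> c = 0\<close> by (simp add: integral_unique)
  moreover have "integral {c..d} (\<lambda>t. ?P t * h t - p t * \<eta> t)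
      = integral {c..d} (\<lambda>t. ?P t * h t) - integral {c..d} (\<lambda>t. p t * \<eta> t)"
    by (intro integral_diff integrable_continuous_real continuous_intros p h \<eta>_cont P_cont)
  ultimately show ?thesis by simp
qed

text \<open>Testing with \<open>F\<close> times a bump makes the integrand a square times a weight
  positive inside \<open>{c<..<d}\<close>. A continuous nonnegative function with integral 0 is 0,
  and continuity carries this to the ends.\<close>

lemma fundamental_lemma_of_variations:
  fixes F :: "real \<Rightarrow> real"
  assumes "c < d" and F: "continuous_on {c..d} F"
    and zero: "\<And>h. continuous_on UNIV h \<Longrightarrow> (\<And>t. t \<notin> {c<..<d} \<Longrightarrow> h t = 0) \<Longrightarrow>
      integral {c..d} (\<lambda>t. F t * h t) = 0"
    and t: "t \<in> {c..d}"
  shows "F t = 0"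
proof -
  \<comment> \<open>Clamping the argument to \<open>{c..d}\<close> extends \<open>F\<close>
    continuously to the line; the positive part cuts the bump off outside the interval.\<close>
  define h where "h = (\<lambda>t. F (max c (min d t)) * max 0 ((t - c) * (d - t)))"
  have "continuous_on UNIV h"
    unfolding h_def
    by (intro continuous_intros continuous_on_compose2[OF F]) (use \<open>c < d\<close> in auto)
  moreover have "h t = 0" if "t \<notin> {c<..<d}" for t
  proof -
    have "(t - c) * (d - t) \<le> 0"
      using that \<open>c < d\<close> unfolding mult_le_0_iff by force
    then show ?thesis by (simp add: h_def)
  qed
  ultimately have int: "integral {c..d} (\<lambda>t. F t * h t) = 0"
    by (rule zero)
  have nonneg: "F t * h t = (F t)\<^sup>2 * ((t - c) * (d - t)) \<and> 0 \<le> (t - c) * (d - t)" if "t \<in> {c..d}" for t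
  proof -
    have "0 \<le> (t - c) * (d - t)" "max c (min d t) = t"
      using that by auto
    then show ?thesis by (simp add: h_def power2_eq_square)
  qed
  have cont: "continuous_on (cbox c d) (\<lambda>t. F t * h t)"
    using F continuous_on_subset[OF \<open>continuous_on UNIV h\<close> subset_UNIV, of "{c..d}"]
    by (simp add: continuous_on_mult)
  have Fh: "\<forall>t\<in>cbox c d. F t * h t = 0"
    using integral_cbox_eq_0_iff[OF cont] int \<open>c < d\<close> nonneg by (simp add: box_real)
  have "F s = 0" if "s \<in> {c<..<d}" for s
  proof -
    have "(F s)\<^sup>2 * ((s - c) * (d - s)) = 0"
      using bspec[OF Fh, of s] nonneg[of s] that by (simp del: mult_eq_0_iff)
    then show ?thesis
      using that by simp
  qed
  moreover have "closure {c<..<d} = {c..d}"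
    using \<open>c < d\<close> by simp
  ultimately show ?thesis
    using F t by (intro continuous_constant_on_closure[of "{c<..<d}" F 0 t]) auto
qed

text \<open>\<open>f\<close> is differentiable only relative to \<open>A\<close>, possibly at a
  boundary point. Along a curve that stays in \<open>A\<close> there is still a two-sided derivative
  in the parameter.\<close>

lemma has_real_derivative_along_curve:
  fixes f :: "'a::real_normed_vector \<Rightarrow> real" and c :: "real \<Rightarrow> 'a"
  assumes f: "(f has_derivative f') (at (c e) within A)" and c: "\<And>e. c e \<in> A"
    and v: "(c has_vector_derivative v) (at e)"
  shows "((\<lambda>e. f (c e)) has_real_derivative f' v) (at e)"
proof -
  interpret f': bounded_linear f'
    using f by (rule has_derivative_bounded_linear)
  have "(f has_derivative f') (at (c e) within range c)"
    using f by (rule has_derivative_subset) (use c in auto)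
  then have "((\<lambda>e. f (c e)) has_derivative (\<lambda>h. f' (h *\<^sub>R v))) (at e)"
    using v unfolding has_vector_derivative_def by (rule has_derivative_in_compose[rotated])
  then show ?thesis
    by (simp add: has_field_derivative_def f'.scaleR mult.commute[of _ "f' v"])
qed

text \<open>The line keeps \<open>t\<close> fixed and so stays in \<open>S \<times> UNIV\<close>
  even for \<open>t\<close> at an end of \<open>S\<close>. The coordinate lines identify the values
  of the total derivative on unit vectors with the partial derivatives.\<close>

lemma partial_derivatives_along_line:
  fixes L :: "real \<times> real \<times> real \<times> real \<Rightarrow> real"
  assumes L: "L differentiable_on (S \<times> UNIV)" and t: "t \<in> S"
  shows "((\<lambda>e. L (t, u + e * p, v + e * q, w + e * r)) has_real_derivative
          pd2 L (t, u + e * p, v + e * q, w + e * r) * p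
        + pd3 L (t, u + e * p, v + e * q, w + e * r) * q
        + pd4 L (t, u + e * p, v + e * q, w + e * r) * r) (at e)"
proof -
  let ?c = "\<lambda>e. (t, u + e * p, v + e * q, w + e * r)"
  obtain L' where L': "(L has_derivative L') (at (?c e) within S \<times> UNIV)"
    using L t unfolding differentiable_on_def differentiable_def by blast
  interpret L': bounded_linear L'
    using L' by (rule has_derivative_bounded_linear)
  have vd: "((\<lambda>e. k + e * l) has_vector_derivative l) (at e)" for k l :: real
    unfolding has_real_derivative_iff_has_vector_derivative[symmetric]
    by (auto intro!: derivative_eq_intros)
  note vderiv = has_vector_derivative_Pair has_vector_derivative_const has_vector_derivative_id
  have "((\<lambda>e. L (?c e)) has_real_derivative L' (0, p, q, r)) (at e)"
    by (rule has_real_derivative_along_curve[where c = ?c and e = e, OF L'])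
       (use t in simp, intro vderiv vd)
  moreover have "((\<lambda>s. L (t, s, v + e * q, w + e * r)) has_real_derivative L' (0, 1, 0, 0)) (at (u + e * p))"
    by (rule has_real_derivative_along_curve[where c = "\<lambda>s. (t, s, v + e * q, w + e * r)", OF L'])
       (use t in simp, intro vderiv vd)
  moreover have "((\<lambda>s. L (t, u + e * p, s, w + e * r)) has_real_derivative L' (0, 0, 1, 0)) (at (v + e * q))"
    by (rule has_real_derivative_along_curve[where c = "\<lambda>s. (t, u + e * p, s, w + e * r)", OF L'])
       (use t in simp, intro vderiv vd)
  moreover have "((\<lambda>s. L (t, u + e * p, v + e * q, s)) has_real_derivative L' (0, 0, 0, 1)) (at (w + e * r))"
    by (rule has_real_derivative_along_curve[where c = "\<lambda>s. (t, u + e * p, v + e * q, s)", OF L'])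
       (use t in simp, intro vderiv vd)
  moreover have "L' (0, p, q, r) = L' (p *\<^sub>R (0, 1, 0, 0) + q *\<^sub>R (0, 0, 1, 0) + r *\<^sub>R (0, 0, 0, 1))"
    by simp
  then have "L' (0, p, q, r) = L' (0, 1, 0, 0) * p + L' (0, 0, 1, 0) * q + L' (0, 0, 0, 1) * r"
    by (simp only: L'.add L'.scaleR real_scaleR_def mult.commute)
  ultimately show ?thesis
    by (simp add: pd2_def pd3_def pd4_def DERIV_imp_deriv)
qed

lemma terminal_cost_derivative_state:
  fixes \<phi> :: "real \<times> real \<Rightarrow> real"
  assumes \<phi>: "\<phi> differentiable_on (S \<times> UNIV)" and t: "t \<in> S"
  shows "((\<lambda>e. \<phi> (t, u + e * p)) has_real_derivative cost_pd2 \<phi> (t, u) * p) (at 0)"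
proof -
  obtain \<phi>' where \<phi>': "(\<phi> has_derivative \<phi>') (at (t, u) within S \<times> UNIV)"
    using \<phi> t unfolding differentiable_on_def differentiable_def by blast
  have "((\<lambda>s. \<phi> (t, s)) has_real_derivative \<phi>' (0, 1)) (at u)"
    by (rule has_real_derivative_along_curve[where c = "\<lambda>s. (t, s)", OF \<phi>'])
       (use t in simp, intro has_vector_derivative_Pair has_vector_derivative_const has_vector_derivative_id)
  then have "((\<lambda>s. \<phi> (t, s)) has_real_derivative cost_pd2 \<phi> (t, u)) (at u)"
    by (simp add: cost_pd2_def DERIV_imp_deriv)
  then have "((\<lambda>s. \<phi> (t, s)) has_real_derivative cost_pd2 \<phi> (t, u)) (at (u + 0 * p))"
    by simp
  then show ?thesis
    by (rule DERIV_chain2) (auto intro!: derivative_eq_intros)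
qed

text \<open>Here the time moves as well, and a curve through a boundary point would leave the strip;
  hence differentiability is taken in a full neighbourhood.\<close>

lemma terminal_cost_derivative_time:
  fixes \<phi> :: "real \<times> real \<Rightarrow> real" and x :: "real \<Rightarrow> real"
  assumes \<phi>: "\<phi> differentiable (at (t, x t))" and x: "(x has_real_derivative x') (at t)"
  shows "((\<lambda>s. \<phi> (s, x s)) has_real_derivative cost_pd1 \<phi> (t, x t) + cost_pd2 \<phi> (t, x t) * x') (at t)"
proof -
  obtain \<phi>' where \<phi>': "(\<phi> has_derivative \<phi>') (at (t, x t))"
    using \<phi> unfolding differentiable_def by blast
  interpret \<phi>': bounded_linear \<phi>'
    using \<phi>' by (rule has_derivative_bounded_linear)
  note vderiv = has_vector_derivative_Pair has_vector_derivative_const has_vector_derivative_id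
  note vx = x[unfolded has_real_derivative_iff_has_vector_derivative]
  have "((\<lambda>s. \<phi> (s, x s)) has_real_derivative \<phi>' (1, x')) (at t)"
    by (rule has_real_derivative_along_curve[where c = "\<lambda>s. (s, x s)", OF \<phi>'])
       (simp, intro vderiv vx)
  moreover have "((\<lambda>s. \<phi> (t, s)) has_real_derivative \<phi>' (0, 1)) (at (x t))"
    by (rule has_real_derivative_along_curve[where c = "\<lambda>s. (t, s)", OF \<phi>'])
       (simp, intro vderiv)
  moreover have "((\<lambda>s. \<phi> (s, x t)) has_real_derivative \<phi>' (1, 0)) (at t)"
    by (rule has_real_derivative_along_curve[where c = "\<lambda>s. (s, x t)", OF \<phi>'])
       (simp, intro vderiv)
  moreover have "\<phi>' (1, x') = \<phi>' ((1, 0) + x' *\<^sub>R (0, 1))"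
    by simp
  then have "\<phi>' (1, x') = \<phi>' (1, 0) + \<phi>' (0, 1) * x'"
    by (simp only: \<phi>'.add \<phi>'.scaleR real_scaleR_def mult.commute)
  ultimately show ?thesis
    by (simp add: cost_pd1_def cost_pd2_def DERIV_imp_deriv)
qed

section \<open>The minimizer and its combined Caputo derivative\<close>

locale delay_minimizer =
  \<alpha>: variable_order a b \<alpha> + \<beta>: variable_order a b \<beta>
  for a b :: real and \<alpha> \<beta> +
  fixes \<sigma> \<gamma>1 \<gamma>2 T :: real and L :: "real \<times> real \<times> real \<times> real \<Rightarrow> real"
    and \<phi> :: "real \<times> real \<Rightarrow> real" and \<psi> x :: "real \<Rightarrow> real"
  assumes aT: "a < T" and \<sigma>: "0 < \<sigma>"
    and L_diff: "L differentiable_on ({a..b} \<times> UNIV)"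
    and pd2_cont: "continuous_on ({a..b} \<times> UNIV) (pd2 L)"
    and pd3_cont: "continuous_on ({a..b} \<times> UNIV) (pd3 L)"
    and pd4_cont: "continuous_on ({a..b} \<times> UNIV) (pd4 L)"
    and \<phi>_diff: "\<phi> differentiable_on ({a..b} \<times> UNIV)"
    and min: "local_minimum a b \<alpha> \<beta> \<gamma>1 \<gamma>2 \<sigma> L \<phi> \<psi> x T"
begin

abbreviation "CD \<equiv> combined_Caputo a b \<alpha> \<beta> \<gamma>1 \<gamma>2"
abbreviation "E \<equiv> delay_args a b \<alpha> \<beta> \<gamma>1 \<gamma>2 \<sigma> x"
abbreviation "g \<equiv> \<lambda>t. pd3 L (E t)"

lemma T_le: "T \<le> b" and ab_less: "a < b"
  using min aT by (auto simp: local_minimum_def admissible_def delay_space_def)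

text \<open>One-sided derivatives on a nondegenerate interval are unique, so the derivative chosen
  inside the definition may be traded for an explicitly given one.\<close>

lemma combined_Caputo_derivative:
  assumes d: "\<And>s. s \<in> {a..b} \<Longrightarrow> (y has_real_derivative d s) (at s within {a..b})" and t: "t \<in> {a..b}"
  shows "CD y t = \<gamma>1 * left_RL_int \<alpha> a d t - \<gamma>2 * right_RL_int \<beta> b d t"
proof -
  have "vector_derivative y (at s within {a..b}) = d s" if "s \<in> {a..b}" for s
    using d[OF that] that ab_less
    by (intro vector_derivative_within_cbox[of a b, simplified])
       (auto simp: has_real_derivative_iff_has_vector_derivative)
  then show ?thesis
    using t left_RL_int_cong[of a t "\<lambda>s. vector_derivative y (at s within {a..b})" d \<alpha>]
      right_RL_int_cong[of t b "\<lambda>s. vector_derivative y (at s within {a..b})" d \<beta>]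
    by (simp add: combined_Caputo_def)
qed

lemma combined_Caputo_linear:
  assumes y: "\<And>s. s \<in> {a..b} \<Longrightarrow> (y has_real_derivative y' s) (at s within {a..b})" "continuous_on {a..b} y'"
    and z: "\<And>s. s \<in> {a..b} \<Longrightarrow> (z has_real_derivative z' s) (at s within {a..b})" "continuous_on {a..b} z'"
    and t: "t \<in> {a..b}"
  shows "CD (\<lambda>t. y t + e * z t) t = CD y t + e * CD z t"
proof -
  have "CD (\<lambda>t. y t + e * z t) t =
      \<gamma>1 * left_RL_int \<alpha> a (\<lambda>s. y' s + e * z' s) t - \<gamma>2 * right_RL_int \<beta> b (\<lambda>s. y' s + e * z' s) t"
    using t by (intro combined_Caputo_derivative) (auto intro!: derivative_eq_intros y z)
  also have "\<dots> = (\<gamma>1 * left_RL_int \<alpha> a y' t - \<gamma>2 * right_RL_int \<beta> b y' t)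
      + e * (\<gamma>1 * left_RL_int \<alpha> a z' t - \<gamma>2 * right_RL_int \<beta> b z' t)"
    using t y z by (simp add: \<alpha>.left_RL_int_linear \<beta>.right_RL_int_linear algebra_simps)
  also have "\<dots> = CD y t + e * CD z t"
    using combined_Caputo_derivative[of y y' t] combined_Caputo_derivative[of z z' t] y z t by simp
  finally show ?thesis .
qed

lemma combined_Caputo_continuous:
  assumes y: "\<And>s. s \<in> {a..b} \<Longrightarrow> (y has_real_derivative y' s) (at s within {a..b})" "continuous_on {a..b} y'"
  shows "continuous_on {a..b} (CD y)"
proof -
  have "continuous_on {a..b} (\<lambda>t. \<gamma>1 * left_RL_int \<alpha> a y' t - \<gamma>2 * right_RL_int \<beta> b y' t)"
    by (intro continuous_intros \<alpha>.continuous_left_RL_int \<beta>.continuous_right_RL_int y)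
  then show ?thesis
    by (rule continuous_on_eq) (rule combined_Caputo_derivative[symmetric, OF y(1)])
qed

lemma x_C1:
  obtains x' where "\<And>t. t \<in> {a - \<sigma>..b} \<Longrightarrow> (x has_real_derivative x' t) (at t within {a - \<sigma>..b})"
    and "continuous_on {a - \<sigma>..b} x'"
proof -
  have "C1_on {a - \<sigma>..b} x"
    using min by (auto simp: local_minimum_def admissible_def delay_space_def)
  with that show ?thesis
    unfolding C1_on_def by blast
qed

lemma x_continuous: "continuous_on {a - \<sigma>..b} x"
proof -
  obtain x' where "\<And>t. t \<in> {a - \<sigma>..b} \<Longrightarrow> (x has_real_derivative x' t) (at t within {a - \<sigma>..b})"
    using x_C1 by blast
  then show ?thesis
    by (rule DERIV_continuous_on)
qed

lemma E_continuous: "continuous_on {a..b} E"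
  unfolding delay_args_def
proof (intro continuous_intros)
  show "continuous_on {a..b} x"
    using x_continuous by (rule continuous_on_subset) (use \<sigma> in auto)
  show "continuous_on {a..b} (\<lambda>t. x (t - \<sigma>))"
    by (rule continuous_on_compose2[OF x_continuous]) (use \<sigma> in \<open>auto intro!: continuous_intros\<close>)
  show "continuous_on {a..b} (CD x)"
    using min by (auto simp: local_minimum_def admissible_def delay_space_def)
qed

lemma continuous_along_E: "continuous_on {a..b} (\<lambda>t. F (E t))" if "continuous_on ({a..b} \<times> UNIV) F"
  by (rule continuous_on_compose2[OF that E_continuous]) (auto simp: delay_args_def)

lemma LE_continuous: "continuous_on {a..b} (\<lambda>t. L (E t))"
  using differentiable_imp_continuous_on[OF L_diff] by (rule continuous_along_E)

end

context delay_minimizer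
begin

lemma x_C1_Icc:
  obtains x' where "\<And>t. t \<in> {a..b} \<Longrightarrow> (x has_real_derivative x' t) (at t within {a..b})"
    and "continuous_on {a..b} x'"
proof -
  obtain x' where x': "\<And>t. t \<in> {a - \<sigma>..b} \<Longrightarrow> (x has_real_derivative x' t) (at t within {a - \<sigma>..b})"
    and cont: "continuous_on {a - \<sigma>..b} x'"
    using x_C1 by blast
  have sub: "{a..b} \<subseteq> {a - \<sigma>..b}"
    using \<sigma> by auto
  have "(x has_real_derivative x' t) (at t within {a..b})" if "t \<in> {a..b}" for t
    using has_field_derivative_subset[OF x' sub] that sub by blast
  with that continuous_on_subset[OF cont sub] show ?thesis
    by blast
qed

lemma minimal:
  obtains \<epsilon> where "0 < \<epsilon>"
    and "\<And>y U. (y, U) \<in> admissible a b \<alpha> \<beta> \<gamma>1 \<gamma>2 \<sigma> \<psi> \<Longrightarrow>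
      delay_norm a b \<alpha> \<beta> \<gamma>1 \<gamma>2 \<sigma> (\<lambda>t. y t - x t, U - T) < \<epsilon> \<Longrightarrow>
      delay_functional a b \<alpha> \<beta> \<gamma>1 \<gamma>2 \<sigma> L \<phi> x T \<le> delay_functional a b \<alpha> \<beta> \<gamma>1 \<gamma>2 \<sigma> L \<phi> y U"
  using min unfolding local_minimum_def by blast

lemma x_admissible: "(x, T) \<in> admissible a b \<alpha> \<beta> \<gamma>1 \<gamma>2 \<sigma> \<psi>"
  using min unfolding local_minimum_def by blast

lemma combined_Caputo_scale:
  assumes y: "\<And>s. s \<in> {a..b} \<Longrightarrow> (y has_real_derivative y' s) (at s within {a..b})" "continuous_on {a..b} y'"
    and t: "t \<in> {a..b}"
  shows "CD (\<lambda>t. e * y t) t = e * CD y t"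
proof -
  have "CD (\<lambda>t. 0 + e * y t) t = CD (\<lambda>t. 0) t + e * CD y t"
    by (rule combined_Caputo_linear[where y' = "\<lambda>s. 0", OF _ _ y t]) auto
  moreover have "CD (\<lambda>t. 0) t = 0"
    using combined_Caputo_derivative[of "\<lambda>t. 0" "\<lambda>t. 0" t] t
    by (simp add: left_RL_int_def right_RL_int_def)
  ultimately show ?thesis by simp
qed

section \<open>Admissible perturbations and the first variation\<close>

context
  fixes h \<eta> :: "real \<Rightarrow> real"
  assumes h: "continuous_on UNIV h" and h0: "\<And>t. t \<le> a \<Longrightarrow> h t = 0"
    and \<eta>_def: "\<eta> = (\<lambda>t. integral {a - \<sigma>..t} h)"
begin

lemma \<eta>_deriv: "(\<eta> has_real_derivative h t) (at t within {a - \<sigma>..b})" if "t \<in> {a - \<sigma>..b}"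
  unfolding \<eta>_def using continuous_on_subset[OF h subset_UNIV] that by (rule integral_has_real_derivative)

lemma \<eta>_deriv_Icc: "(\<eta> has_real_derivative h t) (at t within {a..b})" if "t \<in> {a..b}"
  by (rule has_field_derivative_subset[OF \<eta>_deriv]) (use that \<sigma> in auto)

lemma \<eta>_eq_0: "\<eta> t = 0" if "t \<le> a"
proof -
  have "\<eta> t = integral {a - \<sigma>..t} (\<lambda>_. 0)"
    unfolding \<eta>_def by (rule integral_cong) (use that h0 in auto)
  then show ?thesis by simp
qed

lemma \<eta>_continuous: "continuous_on {a - \<sigma>..b} \<eta>"
  by (rule DERIV_continuous_on) (rule \<eta>_deriv)

lemma h_continuous: "continuous_on S h"
  by (rule continuous_on_subset[OF h]) simp

lemma CD_\<eta>_continuous: "continuous_on {a..b} (CD \<eta>)"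
  by (rule combined_Caputo_continuous[OF \<eta>_deriv_Icc h_continuous])

lemma CD_perturbed: "CD (\<lambda>t. x t + e * \<eta> t) t = CD x t + e * CD \<eta> t" if "t \<in> {a..b}"
proof -
  obtain x' where x': "\<And>t. t \<in> {a..b} \<Longrightarrow> (x has_real_derivative x' t) (at t within {a..b})"
    and "continuous_on {a..b} x'"
    using x_C1_Icc by blast
  from this \<eta>_deriv_Icc h_continuous that show ?thesis
    by (rule combined_Caputo_linear)
qed

lemma perturbed_admissible: "(\<lambda>t. x t + e * \<eta> t, T) \<in> admissible a b \<alpha> \<beta> \<gamma>1 \<gamma>2 \<sigma> \<psi>"
proof -
  obtain x' where x': "\<And>t. t \<in> {a - \<sigma>..b} \<Longrightarrow> (x has_real_derivative x' t) (at t within {a - \<sigma>..b})"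
    and x'_cont: "continuous_on {a - \<sigma>..b} x'"
    using x_C1 by blast
  have "C1_on {a - \<sigma>..b} (\<lambda>t. x t + e * \<eta> t)"
    unfolding C1_on_def
  proof (intro exI conjI ballI)
    show "continuous_on {a - \<sigma>..b} (\<lambda>t. x' t + e * h t)"
      by (intro continuous_intros x'_cont h_continuous)
    show "((\<lambda>t. x t + e * \<eta> t) has_real_derivative x' t + e * h t) (at t within {a - \<sigma>..b})"
      if "t \<in> {a - \<sigma>..b}" for t
      by (intro DERIV_add DERIV_cmult x'[OF that] \<eta>_deriv[OF that])
  qed
  moreover have "continuous_on {a..b} (CD (\<lambda>t. x t + e * \<eta> t))"
  proof (rule continuous_on_eq)
    show "continuous_on {a..b} (\<lambda>t. CD x t + e * CD \<eta> t)"
      using x_admissible by (intro continuous_intros CD_\<eta>_continuous) (auto simp: admissible_def delay_space_def)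
  qed (simp add: CD_perturbed)
  ultimately show ?thesis
    using x_admissible by (auto simp: admissible_def delay_space_def \<eta>_eq_0)
qed

lemma perturbation_norm:
  obtains N where "0 \<le> N"
    and "\<And>e. delay_norm a b \<alpha> \<beta> \<gamma>1 \<gamma>2 \<sigma> (\<lambda>t. (x t + e * \<eta> t) - x t, T - T) \<le> \<bar>e\<bar> * N"
proof -
  have "bounded (\<eta> ` {a - \<sigma>..b})" "bounded (CD \<eta> ` {a..b})"
    using \<eta>_continuous CD_\<eta>_continuous compact_continuous_image compact_imp_bounded by blast+
  then obtain N1 N2 where N: "0 < N1" "0 < N2"
    and N1: "\<And>s. s \<in> {a - \<sigma>..b} \<Longrightarrow> \<bar>\<eta> s\<bar> \<le> N1" and N2: "\<And>s. s \<in> {a..b} \<Longrightarrow> \<bar>CD \<eta> s\<bar> \<le> N2"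
    unfolding bounded_pos by auto
  have "delay_norm a b \<alpha> \<beta> \<gamma>1 \<gamma>2 \<sigma> (\<lambda>t. (x t + e * \<eta> t) - x t, T - T) \<le> \<bar>e\<bar> * (N1 + N2)" for e
  proof -
    have "(SUP s\<in>{a - \<sigma>..b}. \<bar>e * \<eta> s\<bar>) \<le> \<bar>e\<bar> * N1"
      using ab_less \<sigma> N1 by (intro cSUP_least) (auto simp: abs_mult mult_left_mono)
    moreover have "(SUP s\<in>{a..b}. \<bar>CD (\<lambda>t. e * \<eta> t) s\<bar>) \<le> \<bar>e\<bar> * N2"
    proof (rule cSUP_least)
      fix s assume s: "s \<in> {a..b}"
      have "CD (\<lambda>t. e * \<eta> t) s = e * CD \<eta> s"
        using combined_Caputo_scale[of \<eta> h s e] \<eta>_deriv_Icc h_continuous s by blast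
      then show "\<bar>CD (\<lambda>t. e * \<eta> t) s\<bar> \<le> \<bar>e\<bar> * N2"
        using N2[OF s] by (simp add: abs_mult mult_left_mono)
    qed (use ab_less in auto)
    ultimately show ?thesis
      by (simp add: delay_norm_def ring_distribs)
  qed
  with N that[of "N1 + N2"] show ?thesis
    by simp
qed

text \<open>Along \<open>x + e * \<eta>\<close> with \<open>T\<close> fixed, the functional is
  differentiable by Leibniz's rule for parameter integrals and has a local minimum at
  \<open>e = 0\<close>.\<close>

lemma first_variation:
  "integral {a..T} (\<lambda>t. pd2 L (E t) * \<eta> t + g t * CD \<eta> t + pd4 L (E t) * \<eta> (t - \<sigma>))
    + cost_pd2 \<phi> (T, x T) * \<eta> T = 0"
proof -
  let ?V = "\<lambda>e t. (t, x t + e * \<eta> t, CD x t + e * CD \<eta> t, x (t - \<sigma>) + e * \<eta> (t - \<sigma>))"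
  let ?V' = "\<lambda>e t. pd2 L (?V e t) * \<eta> t + pd3 L (?V e t) * CD \<eta> t + pd4 L (?V e t) * \<eta> (t - \<sigma>)"
  define J where "J e = delay_functional a b \<alpha> \<beta> \<gamma>1 \<gamma>2 \<sigma> L \<phi> (\<lambda>t. x t + e * \<eta> t) T" for e
  have J_eq: "J e = integral (cbox a T) (\<lambda>t. L (?V e t)) + \<phi> (T, x T + e * \<eta> T)" for e
    unfolding J_def delay_functional_def delay_args_def
    by (intro arg_cong2[where f = "(+)"] refl, unfold cbox_interval, intro integral_cong)
       (use T_le in \<open>simp add: CD_perturbed\<close>)
  have sub: "{a..T} \<subseteq> {a..b}" "{a..T} \<subseteq> {a - \<sigma>..b}"
    using T_le \<sigma> by auto
  have CDx: "continuous_on {a..b} (CD x)"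
    using x_admissible by (auto simp: admissible_def delay_space_def)
  \<comment> \<open>Continuity in \<open>e\<close> and \<open>t\<close> jointly: Leibniz's rule asks
    for a derivative continuous in both variables, which is where the continuity of the partial
    derivatives of \<open>L\<close> enters.\<close>
  have V: "continuous_on (UNIV \<times> {a..T}) (\<lambda>p. ?V (fst p) (snd p))"
    by (intro continuous_on_Pair continuous_on_add continuous_on_mult continuous_on_fst continuous_on_snd continuous_on_id
          continuous_on_compose2[OF x_continuous] continuous_on_compose2[OF \<eta>_continuous]
          continuous_on_compose2[OF CDx] continuous_on_compose2[OF CD_\<eta>_continuous] continuous_on_diff continuous_on_const)
       (use T_le \<sigma> in auto)
  have V_slice: "continuous_on {a..T} (\<lambda>t. ?V e t)" for e
  proof -
    have "continuous_on {a..T} (\<lambda>t. (e, t))"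
      by (intro continuous_on_Pair continuous_on_const continuous_on_id)
    from continuous_on_compose2[OF V this] show ?thesis
      by auto
  qed
  have comp: "continuous_on (UNIV \<times> {a..T}) (\<lambda>p. F (?V (fst p) (snd p)))"
    if "continuous_on ({a..b} \<times> UNIV) F" for F :: "real \<times> real \<times> real \<times> real \<Rightarrow> real"
    by (rule continuous_on_compose2[OF that V]) (use T_le in auto)
  have "((\<lambda>e. integral (cbox a T) (\<lambda>t. L (?V e t))) has_field_derivative integral (cbox a T) (?V' 0)) (at 0 within UNIV)"
  proof (rule leibniz_rule_field_derivative)
    show "((\<lambda>e. L (?V e t)) has_real_derivative ?V' e t) (at e within UNIV)" if "t \<in> cbox a T" for e t
      by (rule partial_derivatives_along_line[OF L_diff]) (use that T_le in auto)
    show "(\<lambda>t. L (?V e t)) integrable_on cbox a T" for e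
      unfolding cbox_interval
      by (intro integrable_continuous_real continuous_on_compose2[OF differentiable_imp_continuous_on[OF L_diff] V_slice])
         (use T_le in auto)
    have "continuous_on (UNIV \<times> cbox a T) (\<lambda>p. ?V' (fst p) (snd p))"
      unfolding cbox_interval
      by (intro continuous_on_add continuous_on_mult comp pd2_cont pd3_cont pd4_cont
            continuous_on_compose2[OF \<eta>_continuous] continuous_on_compose2[OF CD_\<eta>_continuous]
            continuous_on_diff continuous_on_const continuous_on_snd continuous_on_id)
         (use T_le \<sigma> in auto)
    then show "continuous_on (UNIV \<times> cbox a T) (\<lambda>(e, t). ?V' e t)"
      by (simp add: split_beta)
  qed auto
  moreover have "((\<lambda>e. \<phi> (T, x T + e * \<eta> T)) has_field_derivative cost_pd2 \<phi> (T, x T) * \<eta> T) (at 0)"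
    by (rule terminal_cost_derivative_state[OF \<phi>_diff]) (use aT T_le in auto)
  ultimately have J': "(J has_field_derivative integral (cbox a T) (?V' 0) + cost_pd2 \<phi> (T, x T) * \<eta> T) (at 0)"
    unfolding J_eq[abs_def] by (intro DERIV_add)
  obtain \<epsilon> where "0 < \<epsilon>"
    and \<epsilon>: "\<And>y U. (y, U) \<in> admissible a b \<alpha> \<beta> \<gamma>1 \<gamma>2 \<sigma> \<psi> \<Longrightarrow>
      delay_norm a b \<alpha> \<beta> \<gamma>1 \<gamma>2 \<sigma> (\<lambda>t. y t - x t, U - T) < \<epsilon> \<Longrightarrow>
      delay_functional a b \<alpha> \<beta> \<gamma>1 \<gamma>2 \<sigma> L \<phi> x T \<le> delay_functional a b \<alpha> \<beta> \<gamma>1 \<gamma>2 \<sigma> L \<phi> y U"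
    using minimal by blast
  obtain N where N: "0 \<le> N"
    "\<And>e. delay_norm a b \<alpha> \<beta> \<gamma>1 \<gamma>2 \<sigma> (\<lambda>t. (x t + e * \<eta> t) - x t, T - T) \<le> \<bar>e\<bar> * N"
    using perturbation_norm by blast
  \<comment> \<open>The radius uses \<open>N + 1\<close> since \<open>N\<close> may be 0.\<close>
  have "J 0 \<le> J e" if "\<bar>0 - e\<bar> < \<epsilon> / (N + 1)" for e
  proof -
    have "\<bar>e\<bar> * N \<le> \<bar>e\<bar> * (N + 1)"
      by (intro mult_left_mono) auto
    also have "\<dots> < \<epsilon>"
      using that N(1) by (simp add: pos_less_divide_eq)
    finally have "delay_norm a b \<alpha> \<beta> \<gamma>1 \<gamma>2 \<sigma> (\<lambda>t. (x t + e * \<eta> t) - x t, T - T) < \<epsilon>"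
      using N(2)[of e] by linarith
    from \<epsilon>[OF perturbed_admissible this] show ?thesis
      by (simp add: J_def)
  qed
  then have "integral (cbox a T) (?V' 0) + cost_pd2 \<phi> (T, x T) * \<eta> T = 0"
    using \<open>0 < \<epsilon>\<close> N(1) by (intro DERIV_local_min[OF J', where d = "\<epsilon> / (N + 1)"]) auto
  then show ?thesis
    by (simp add: delay_args_def)
qed

end

end

section \<open>Necessary conditions\<close>

text \<open>For differentiating an identity between fractional integrals: the sum inherits
  differentiability from \<open>k\<close>, and \<open>sum_splits\<close> passes it on to the
  separate terms. At the ends of \<open>{c..d}\<close> all derivatives are one-sided.\<close>

lemma split_derivative:
  fixes f h k :: "real \<Rightarrow> real"
  assumes "c < d" and t: "t \<in> {c..d}"
    and eq: "\<And>s. s \<in> {c..d} \<Longrightarrow> p * f s + q * h s = k s"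
    and k: "(k has_real_derivative k') (at t within {c..d})"
    and splits: "sum_splits p f q h t {c..d}"
  shows "terms_differentiable p f q h t {c..d}"
    and "p * vector_derivative f (at t within {c..d}) + q * vector_derivative h (at t within {c..d}) = k'"
proof -
  let ?at = "at t within {c..d}"
  have sum: "((\<lambda>s. p * f s + q * h s) has_real_derivative k') ?at"
    by (rule has_field_derivative_transform_within[OF k zero_less_one t]) (simp add: eq)
  then show terms: "terms_differentiable p f q h t {c..d}"
    using splits terms_differentiable_iff_sum_splits real_differentiable_def by blast
  \<comment> \<open>For \<open>r = 0\<close> the function \<open>u\<close> may fail to be
    differentiable and its \<open>vector_derivative\<close> be arbitrary; the product is 0 all the
    same.\<close>
  have scaled: "((\<lambda>s. r * u s) has_vector_derivative r * vector_derivative u ?at) ?at"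
    if "r \<noteq> 0 \<longrightarrow> u differentiable ?at" for r and u :: "real \<Rightarrow> real"
  proof (cases "r = 0")
    case False
    then have "(u has_vector_derivative vector_derivative u ?at) ?at"
      using that vector_derivative_works by blast
    then show ?thesis
      by (rule has_vector_derivative_mult_right)
  qed simp
  have "((\<lambda>s. p * f s + q * h s) has_vector_derivative
      p * vector_derivative f ?at + q * vector_derivative h ?at) ?at"
    using terms unfolding terms_differentiable_def
    by (intro has_vector_derivative_add scaled) auto
  moreover have "((\<lambda>s. p * f s + q * h s) has_vector_derivative k') ?at"
    using sum unfolding has_real_derivative_iff_has_vector_derivative .
  ultimately show "p * vector_derivative f ?at + q * vector_derivative h ?at = k'"
    using vector_derivative_unique_within_closed_interval[of c d t] \<open>c < d\<close> t by simp
qed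

lemma sum_splits_minus: "sum_splits p f (- q) h t S \<longleftrightarrow> sum_splits p f q h t S"
  by (simp add: sum_splits_def)

lemma terms_differentiable_minus: "terms_differentiable p f (- q) h t S \<longleftrightarrow> terms_differentiable p f q h t S"
  by (simp add: terms_differentiable_def)

context delay_minimizer
begin

abbreviation "p2 \<equiv> \<lambda>t. pd2 L (E t)"
abbreviation "p4 \<equiv> \<lambda>t. pd4 L (E t)"

text \<open>
  The tail integral of the delay term is empty, hence \<open>0\<close>, once \<open>t + \<sigma> > T\<close>; this covers both
  the short and the long delay.
\<close>

definition delay_tail :: "real \<Rightarrow> real" where
  "delay_tail t = integral {t + \<sigma>..T} p4"

text \<open>The factor of \<open>h\<close> in the first variation on \<open>{a..T}\<close>: the
  Euler--Lagrange expression in integrated (du Bois-Reymond) form. The constant cost term comes from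
  \<open>\<eta> T\<close>, the integral of \<open>h\<close> over \<open>{a..T}\<close>.\<close>

definition residual :: "real \<Rightarrow> real" where
  "residual t = \<gamma>1 * right_RL_int \<alpha> T g t - \<gamma>2 * left_RL_int \<beta> a g t + integral {t..T} p2 + delay_tail t
    + cost_pd2 \<phi> (T, x T)"

text \<open>Values of \<open>h\<close> beyond \<open>T\<close> reach the functional only through the
  right-sided Caputo term, whose integral runs up to \<open>b\<close>. For \<open>t \<ge> T\<close>
  the difference of the two left integrals is the integral over \<open>{a..T}\<close> alone.\<close>

definition outer_residual :: "real \<Rightarrow> real" where
  "outer_residual t = \<gamma>2 * (left_RL_int \<beta> a g t - left_RL_int \<beta> T g t)"

section \<open>Regularity of the residuals\<close>

lemma coefficients_continuous:
  "continuous_on {a..b} g" "continuous_on {a..b} p2" "continuous_on {a..b} p4"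
  by (intro continuous_along_E pd2_cont pd3_cont pd4_cont)+

lemma coefficients_continuous_subset:
  assumes "S \<subseteq> {a..b}"
  shows "continuous_on S g" "continuous_on S p2" "continuous_on S p4"
  using coefficients_continuous assms continuous_on_subset by blast+

lemma tail_integral_derivative:
  "((\<lambda>t. integral {t..T} p) has_real_derivative - p t) (at t within {a..T})"
  if "continuous_on {a..T} p" "t \<in> {a..T}" for p :: "real \<Rightarrow> real"
  using that by (rule integral_has_real_derivative')

lemma tail_integral_continuous:
  "continuous_on {a..T} (\<lambda>t. integral {t..T} p)" if "continuous_on {a..T} p" for p :: "real \<Rightarrow> real"
  by (rule DERIV_continuous_on) (rule tail_integral_derivative[OF that])

lemma delay_tail_eq_0: "delay_tail t = 0" if "T \<le> t + \<sigma>"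
  using that by (cases "t + \<sigma> = T") (auto simp: delay_tail_def)

lemma delay_tail_continuous: "continuous_on {a - \<sigma>..T} delay_tail"
proof -
  have p4: "continuous_on {a..T} p4"
    by (rule coefficients_continuous_subset) (use T_le in auto)
  \<comment> \<open>Clamping at \<open>T\<close> keeps the lower limit in \<open>{a..T}\<close>; it
    only replaces an empty interval by a point, so the value stays 0.\<close>
  have "continuous_on {a - \<sigma>..T} (\<lambda>t. integral {min (t + \<sigma>) T..T} p4)"
    by (rule continuous_on_compose2[OF tail_integral_continuous[OF p4]])
       (use aT in \<open>auto intro!: continuous_intros\<close>)
  then show ?thesis
  proof (rule continuous_on_eq)
    show "integral {min (t + \<sigma>) T..T} p4 = delay_tail t" for t
      using delay_tail_eq_0[of t] by (cases "T \<le> t + \<sigma>") (simp_all add: delay_tail_def)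
  qed
qed

lemma delay_tail_derivative: "(delay_tail has_real_derivative - p4 (t + \<sigma>)) (at t within {a..T - \<sigma>})"
  if t: "t \<in> {a..T - \<sigma>}"
proof -
  have p4: "continuous_on {a..T} p4"
    by (rule coefficients_continuous_subset) (use T_le in auto)
  have "((\<lambda>t. integral {t..T} p4) has_real_derivative - p4 (t + \<sigma>)) (at (t + \<sigma>) within (\<lambda>t. t + \<sigma>) ` {a..T - \<sigma>})"
    by (rule has_field_derivative_subset[OF tail_integral_derivative[OF p4]]) (use t \<sigma> in auto)
  moreover have "((\<lambda>t. t + \<sigma>) has_real_derivative 1) (at t within {a..T - \<sigma>})"
    by (auto intro!: derivative_eq_intros)
  ultimately have "((\<lambda>t. integral {t..T} p4) \<circ> (\<lambda>t. t + \<sigma>) has_real_derivative - p4 (t + \<sigma>) * 1) (at t within {a..T - \<sigma>})"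
    by (rule DERIV_image_chain)
  then show ?thesis
    by (simp add: o_def delay_tail_def[abs_def])
qed

lemma RL_continuous:
  "continuous_on {a..T} (right_RL_int \<alpha> T g)"
  "continuous_on {a..b} (left_RL_int \<beta> a g)"
  "continuous_on {T..b} (left_RL_int \<beta> T g)"
proof -
  interpret \<alpha>T: variable_order a T \<alpha>
    by (rule \<alpha>.subinterval) (use aT T_le in auto)
  interpret \<beta>T: variable_order T b \<beta>
    by (rule \<beta>.subinterval) (use aT T_le in auto)
  show "continuous_on {a..T} (right_RL_int \<alpha> T g)"
    by (rule \<alpha>T.continuous_right_RL_int, rule coefficients_continuous_subset) (use T_le in auto)
  show "continuous_on {a..b} (left_RL_int \<beta> a g)"
    by (rule \<beta>.continuous_left_RL_int, rule coefficients_continuous)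
  show "continuous_on {T..b} (left_RL_int \<beta> T g)"
    by (rule \<beta>T.continuous_left_RL_int, rule coefficients_continuous_subset) (use aT in auto)
qed

lemma residual_continuous: "continuous_on {a..T} residual"
proof -
  have "continuous_on {a..T} (left_RL_int \<beta> a g)" "continuous_on {a..T} delay_tail"
    using T_le \<sigma> by (auto intro: continuous_on_subset[OF RL_continuous(2)] continuous_on_subset[OF delay_tail_continuous])
  moreover have "continuous_on {a..T} p2"
    by (rule coefficients_continuous_subset) (use T_le in auto)
  ultimately show ?thesis
    unfolding residual_def by (intro continuous_on_add continuous_on_diff continuous_on_mult_left
        continuous_on_const RL_continuous tail_integral_continuous)
qed

lemma outer_residual_continuous: "continuous_on {T..b} outer_residual"
proof -
  have "continuous_on {T..b} (left_RL_int \<beta> a g)"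
    by (rule continuous_on_subset[OF RL_continuous(2)]) (use aT in auto)
  then show ?thesis
    unfolding outer_residual_def by (intro continuous_on_diff continuous_on_mult_left RL_continuous)
qed

text \<open>Every term of the first variation is rewritten as an integral against \<open>h\<close>:
  the state and delay terms by ordinary integration by parts, the two Caputo terms by adjointness of
  the fractional integrals.\<close>

lemma weak_Euler_Lagrange:
  assumes h: "continuous_on UNIV h" and h0: "\<And>t. t \<le> a \<Longrightarrow> h t = 0"
  shows "integral {a..T} (\<lambda>t. residual t * h t) = integral {T..b} (\<lambda>t. outer_residual t * h t)"
proof -
  define \<eta> where "\<eta> = (\<lambda>t. integral {a - \<sigma>..t} h)"
  note \<eta>_facts = \<eta>_deriv[OF h h0 \<eta>_def] \<eta>_deriv_Icc[OF h h0 \<eta>_def] \<eta>_eq_0[OF h h0 \<eta>_def]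
  interpret \<alpha>T: variable_order a T \<alpha>
    by (rule \<alpha>.subinterval) (use aT T_le in auto)
  interpret \<beta>T: variable_order T b \<beta>
    by (rule \<beta>.subinterval) (use aT T_le in auto)
  have sub: "{a..T} \<subseteq> {a..b}" "{T..b} \<subseteq> {a..b}"
    using aT T_le by auto
  note coeffs = coefficients_continuous_subset[OF sub(1)]
  have h_on: "continuous_on S h" for S
    by (rule continuous_on_subset[OF h]) simp
  have \<eta>_cont: "continuous_on {a - \<sigma>..b} \<eta>"
    by (rule DERIV_continuous_on) (rule \<eta>_facts(1))
  have Lf: "continuous_on {a..T} (left_RL_int \<beta> a g)" "continuous_on {T..b} (left_RL_int \<beta> a g)"
    using sub RL_continuous(2) continuous_on_subset by blast+
  have \<alpha>h: "continuous_on {a..b} (left_RL_int \<alpha> a h)" and \<beta>h: "continuous_on {a..b} (right_RL_int \<beta> b h)"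
    by (rule \<alpha>.continuous_left_RL_int \<beta>.continuous_right_RL_int, rule h_on)+
  note integrable = integrable_continuous_real

  have "integral {a..T} (\<lambda>t. p2 t * \<eta> t) = integral {a..T} (\<lambda>t. integral {t..T} p2 * h t)"
  proof (rule integral_primitive_by_parts)
    show "(\<eta> has_real_derivative h t) (at t within {a..T})" if "t \<in> {a..T}" for t
      by (rule has_field_derivative_subset[OF \<eta>_facts(2)]) (use that sub in auto)
  qed (use aT coeffs h_on \<eta>_facts(3) in auto)
  note state = this

  \<comment> \<open>The shifted \<open>\<eta>\<close> is a primitive of the shifted \<open>h\<close>
    and vanishes at \<open>a\<close>, because \<open>\<eta>\<close> is 0 on the whole history
    interval.\<close>
  have "integral {a..T} (\<lambda>t. p4 t * \<eta> (t - \<sigma>)) = integral {a..T} (\<lambda>t. integral {t..T} p4 * h (t - \<sigma>))"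
  proof (rule integral_primitive_by_parts)
    show "((\<lambda>t. \<eta> (t - \<sigma>)) has_real_derivative h (t - \<sigma>)) (at t within {a..T})" if "t \<in> {a..T}" for t
    proof -
      have "(\<eta> has_real_derivative h (t - \<sigma>)) (at (t - \<sigma>) within (\<lambda>t. t - \<sigma>) ` {a..T})"
        by (rule has_field_derivative_subset[OF \<eta>_facts(1)]) (use that T_le \<sigma> in auto)
      moreover have "((\<lambda>t. t - \<sigma>) has_real_derivative 1) (at t within {a..T})"
        by (auto intro!: derivative_eq_intros)
      ultimately have "(\<eta> \<circ> (\<lambda>t. t - \<sigma>) has_real_derivative h (t - \<sigma>) * 1) (at t within {a..T})"
        by (rule DERIV_image_chain)
      then show ?thesis
        by (simp add: o_def)
    qed
    show "continuous_on {a..T} (\<lambda>t. h (t - \<sigma>))"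
      by (rule continuous_on_compose2[OF h]) (auto intro!: continuous_intros)
  qed (use aT coeffs \<sigma> \<eta>_facts(3) in auto)
  also have "\<dots> = integral {a - \<sigma>..T - \<sigma>} (\<lambda>t. delay_tail t * h t)"
    using integral_shift_real_ivl[of a \<sigma> T "\<lambda>t. integral {t..T} p4 * h (t - \<sigma>)"] by (simp add: delay_tail_def)
  \<comment> \<open>Both ranges may be enlarged to \<open>{a - \<sigma>..T}\<close>:
    \<open>delay_tail\<close> is 0 from \<open>T - \<sigma>\<close> on and \<open>h\<close> is 0 up
    to \<open>a\<close>. This needs no comparison of \<open>\<sigma>\<close> with
    \<open>T - a\<close>.\<close>
  also have "\<dots> = integral {a..T} (\<lambda>t. delay_tail t * h t)"
  proof -
    have Wh: "(\<lambda>t. delay_tail t * h t) integrable_on {a - \<sigma>..T}"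
      by (intro integrable continuous_on_mult delay_tail_continuous h_on)
    have "integral {T - \<sigma>..T} (\<lambda>t. delay_tail t * h t) = integral {T - \<sigma>..T} (\<lambda>_. 0)"
      by (rule integral_cong) (simp add: delay_tail_eq_0)
    moreover have "integral {a - \<sigma>..a} (\<lambda>t. delay_tail t * h t) = integral {a - \<sigma>..a} (\<lambda>_. 0)"
      by (rule integral_cong) (simp add: h0)
    ultimately show ?thesis
      using Henstock_Kurzweil_Integration.integral_combine[OF _ _ Wh, of "T - \<sigma>"] Henstock_Kurzweil_Integration.integral_combine[OF _ _ Wh, of a] aT \<sigma> by simp
  qed
  finally have delay: "integral {a..T} (\<lambda>t. p4 t * \<eta> (t - \<sigma>)) = integral {a..T} (\<lambda>t. delay_tail t * h t)" .

  \<comment> \<open>For \<open>t \<le> T\<close> the left integral sees \<open>h\<close> only up to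
    \<open>T\<close>, so adjointness is applied on \<open>{a..T}\<close> itself.\<close>
  have "integral {a..T} (\<lambda>t. g t * left_RL_int \<alpha> a h t) = integral {a..T} (\<lambda>t. h t * right_RL_int \<alpha> T g t)"
    by (rule \<alpha>T.fractional_integration_by_parts[OF h_on coeffs(1)])
  note left = this

  \<comment> \<open>The right integral looks ahead to \<open>b\<close>, although the functional
    stops at \<open>T\<close>. The integral over \<open>{a..T}\<close> is therefore obtained by
    applying adjointness on \<open>{a..b}\<close> and on \<open>{T..b}\<close> and
    subtracting.\<close>
  have "integral {a..b} (\<lambda>t. h t * left_RL_int \<beta> a g t) = integral {a..b} (\<lambda>t. g t * right_RL_int \<beta> b h t)"
    by (rule \<beta>.fractional_integration_by_parts[OF coefficients_continuous(1) h_on])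
  moreover have "integral {T..b} (\<lambda>t. h t * left_RL_int \<beta> T g t) = integral {T..b} (\<lambda>t. g t * right_RL_int \<beta> b h t)"
    by (rule \<beta>T.fractional_integration_by_parts[OF coefficients_continuous_subset(1)[OF sub(2)] h_on])
  moreover have "integral {a..T} (\<lambda>t. g t * right_RL_int \<beta> b h t) + integral {T..b} (\<lambda>t. g t * right_RL_int \<beta> b h t)
      = integral {a..b} (\<lambda>t. g t * right_RL_int \<beta> b h t)"
    by (intro Henstock_Kurzweil_Integration.integral_combine integrable continuous_on_mult coefficients_continuous \<beta>h) (use aT T_le in auto)
  moreover have "integral {a..T} (\<lambda>t. h t * left_RL_int \<beta> a g t) + integral {T..b} (\<lambda>t. h t * left_RL_int \<beta> a g t)
      = integral {a..b} (\<lambda>t. h t * left_RL_int \<beta> a g t)"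
    by (intro Henstock_Kurzweil_Integration.integral_combine integrable continuous_on_mult h_on RL_continuous) (use aT T_le in auto)
  moreover have "integral {T..b} (\<lambda>t. h t * left_RL_int \<beta> a g t - h t * left_RL_int \<beta> T g t) =
      integral {T..b} (\<lambda>t. h t * left_RL_int \<beta> a g t) - integral {T..b} (\<lambda>t. h t * left_RL_int \<beta> T g t)"
    by (intro integral_diff integrable continuous_on_mult h_on RL_continuous Lf)
  ultimately have right: "integral {a..T} (\<lambda>t. g t * right_RL_int \<beta> b h t) =
      integral {a..T} (\<lambda>t. h t * left_RL_int \<beta> a g t)
      + integral {T..b} (\<lambda>t. h t * left_RL_int \<beta> a g t - h t * left_RL_int \<beta> T g t)"
    by linarith

  have \<eta>T: "\<eta> T = integral {a..T} h"
  proof -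
    have "integral {a - \<sigma>..a} h + integral {a..T} h = integral {a - \<sigma>..T} h"
      by (intro Henstock_Kurzweil_Integration.integral_combine integrable h_on) (use aT \<sigma> in auto)
    then show ?thesis
      using \<eta>_facts(3)[of a] by (simp add: \<eta>_def)
  qed

  have CD\<eta>: "CD \<eta> t = \<gamma>1 * left_RL_int \<alpha> a h t - \<gamma>2 * right_RL_int \<beta> b h t" if "t \<in> {a..T}" for t
    by (rule combined_Caputo_derivative) (use that sub \<eta>_facts(2) in auto)
  have "integral {a..T} (\<lambda>t. p2 t * \<eta> t + g t * CD \<eta> t + p4 t * \<eta> (t - \<sigma>))
    = integral {a..T} (\<lambda>t. p2 t * \<eta> t + (\<gamma>1 * (g t * left_RL_int \<alpha> a h t) - \<gamma>2 * (g t * right_RL_int \<beta> b h t))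
        + p4 t * \<eta> (t - \<sigma>))"
    by (rule integral_cong) (simp add: CD\<eta> algebra_simps)
  also have "\<dots> = integral {a..T} (\<lambda>t. p2 t * \<eta> t)
      + (\<gamma>1 * integral {a..T} (\<lambda>t. g t * left_RL_int \<alpha> a h t)
        - \<gamma>2 * integral {a..T} (\<lambda>t. g t * right_RL_int \<beta> b h t))
      + integral {a..T} (\<lambda>t. p4 t * \<eta> (t - \<sigma>))"
  proof -
    have i: "(\<lambda>t. p2 t * \<eta> t) integrable_on {a..T}" "(\<lambda>t. p4 t * \<eta> (t - \<sigma>)) integrable_on {a..T}"
      "(\<lambda>t. g t * left_RL_int \<alpha> a h t) integrable_on {a..T}"
      "(\<lambda>t. g t * right_RL_int \<beta> b h t) integrable_on {a..T}"
    proof -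
      have \<eta>: "continuous_on {a..T} \<eta>"
        by (rule continuous_on_subset[OF \<eta>_cont]) (use T_le \<sigma> in auto)
      have \<eta>': "continuous_on {a..T} (\<lambda>t. \<eta> (t - \<sigma>))"
        by (rule continuous_on_compose2[OF \<eta>_cont])
          (use T_le \<sigma> in \<open>auto intro: continuous_on_diff continuous_on_id continuous_on_const\<close>)
      show "(\<lambda>t. p2 t * \<eta> t) integrable_on {a..T}" "(\<lambda>t. p4 t * \<eta> (t - \<sigma>)) integrable_on {a..T}"
        "(\<lambda>t. g t * left_RL_int \<alpha> a h t) integrable_on {a..T}"
        "(\<lambda>t. g t * right_RL_int \<beta> b h t) integrable_on {a..T}"
        by (intro integrable continuous_on_mult coeffs \<eta> \<eta>' continuous_on_subset[OF \<alpha>h sub(1)]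
            continuous_on_subset[OF \<beta>h sub(1)])+
    qed
    show ?thesis
      by (intro integral_unique has_integral_add has_integral_diff has_integral_mult_right integrable_integral i)
  qed
  finally have "integral {a..T} (\<lambda>t. integral {t..T} p2 * h t)
      + (\<gamma>1 * integral {a..T} (\<lambda>t. h t * right_RL_int \<alpha> T g t)
        - \<gamma>2 * (integral {a..T} (\<lambda>t. h t * left_RL_int \<beta> a g t)
          + integral {T..b} (\<lambda>t. h t * left_RL_int \<beta> a g t - h t * left_RL_int \<beta> T g t)))
      + integral {a..T} (\<lambda>t. delay_tail t * h t) + cost_pd2 \<phi> (T, x T) * integral {a..T} h = 0"
    using first_variation[OF h h0 \<eta>_def] by (simp add: state delay left right \<eta>T)
  moreover have "integral {a..T} (\<lambda>t. residual t * h t) = integral {a..T} (\<lambda>t. integral {t..T} p2 * h t)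
      + (\<gamma>1 * integral {a..T} (\<lambda>t. h t * right_RL_int \<alpha> T g t)
        - \<gamma>2 * integral {a..T} (\<lambda>t. h t * left_RL_int \<beta> a g t))
      + integral {a..T} (\<lambda>t. delay_tail t * h t) + cost_pd2 \<phi> (T, x T) * integral {a..T} h"
  proof -
    have i: "(\<lambda>t. integral {t..T} p2 * h t) integrable_on {a..T}" "(\<lambda>t. delay_tail t * h t) integrable_on {a..T}"
      "(\<lambda>t. h t * right_RL_int \<alpha> T g t) integrable_on {a..T}"
      "(\<lambda>t. h t * left_RL_int \<beta> a g t) integrable_on {a..T}" "h integrable_on {a..T}"
    proof -
      have delay_tail: "continuous_on {a..T} delay_tail"
        by (rule continuous_on_subset[OF delay_tail_continuous]) (use \<sigma> in auto)
      show "(\<lambda>t. integral {t..T} p2 * h t) integrable_on {a..T}" "(\<lambda>t. delay_tail t * h t) integrable_on {a..T}"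
        "(\<lambda>t. h t * right_RL_int \<alpha> T g t) integrable_on {a..T}"
        "(\<lambda>t. h t * left_RL_int \<beta> a g t) integrable_on {a..T}" "h integrable_on {a..T}"
        by (intro integrable continuous_on_mult delay_tail tail_integral_continuous coeffs RL_continuous Lf h_on)+
    qed
    have "(\<lambda>t. residual t * h t) = (\<lambda>t. integral {t..T} p2 * h t
        + (\<gamma>1 * (h t * right_RL_int \<alpha> T g t) - \<gamma>2 * (h t * left_RL_int \<beta> a g t))
        + delay_tail t * h t + cost_pd2 \<phi> (T, x T) * h t)"
      by (simp add: fun_eq_iff residual_def algebra_simps)
    then show ?thesis
      by (simp only:)
         (intro integral_unique has_integral_add has_integral_diff has_integral_mult_right integrable_integral i)
  qed
  moreover have "integral {T..b} (\<lambda>t. outer_residual t * h t)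
      = \<gamma>2 * integral {T..b} (\<lambda>t. h t * left_RL_int \<beta> a g t - h t * left_RL_int \<beta> T g t)"
    by (simp add: outer_residual_def algebra_simps flip: integral_mult_right)
  ultimately show ?thesis
    by (simp add: algebra_simps)
qed

text \<open>A test function supported in \<open>{a<..<T}\<close> removes the outer integral from the
  weak equation, and the fundamental lemma applies to what is left.\<close>

lemma residual_eq_0: "residual t = 0" if t: "t \<in> {a..T}"
proof (rule fundamental_lemma_of_variations[OF aT residual_continuous _ t])
  fix h :: "real \<Rightarrow> real"
  assume h: "continuous_on UNIV h" and h0: "\<And>t. t \<notin> {a<..<T} \<Longrightarrow> h t = 0"
  have "integral {a..T} (\<lambda>t. residual t * h t) = integral {T..b} (\<lambda>t. outer_residual t * h t)"
    by (rule weak_Euler_Lagrange[OF h]) (simp add: h0)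
  also have "\<dots> = integral {T..b} (\<lambda>_. 0)"
    by (rule integral_cong) (simp add: h0)
  finally show "integral {a..T} (\<lambda>t. residual t * h t) = 0"
    by simp
qed

lemma outer_residual_eq_0: "outer_residual t = 0" if "T < b" and t: "t \<in> {T..b}"
proof (rule fundamental_lemma_of_variations[OF \<open>T < b\<close> outer_residual_continuous _ t])
  fix h :: "real \<Rightarrow> real"
  assume h: "continuous_on UNIV h" and h0: "\<And>t. t \<notin> {T<..<b} \<Longrightarrow> h t = 0"
  have "integral {T..b} (\<lambda>t. outer_residual t * h t) = integral {a..T} (\<lambda>t. residual t * h t)"
    by (rule weak_Euler_Lagrange[OF h, symmetric]) (use aT h0 in auto)
  also have "\<dots> = integral {a..T} (\<lambda>_. 0)"
    by (rule integral_cong) (simp add: h0)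
  finally show "integral {T..b} (\<lambda>t. outer_residual t * h t) = 0"
    by simp
qed

text \<open>The identity \<open>residual s = 0\<close> is differentiated on the interval of the
  equation. The term \<open>w\<close>, minus the derivative of \<open>delay_tail\<close>, will be
  the advanced \<open>p4\<close> or 0, so one lemma covers both delay regimes.\<close>

lemma Euler_Lagrange:
  assumes "c < d" and sub: "{c..d} \<subseteq> {a..T}" and t: "t \<in> {c..d}"
    and delay_tail: "(delay_tail has_real_derivative - w) (at t within {c..d})"
    and splits: "sum_splits \<gamma>2 (left_RL_int \<beta> a g) \<gamma>1 (right_RL_int \<alpha> T g) t {c..d}"
  shows "terms_differentiable \<gamma>2 (left_RL_int \<beta> a g) \<gamma>1 (right_RL_int \<alpha> T g) t {c..d}"
    and "p2 t + dual_RL_deriv {c..d} a T \<beta> \<alpha> \<gamma>2 \<gamma>1 g t + w = 0"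
proof -
  let ?k = "\<lambda>s. integral {s..T} p2 + delay_tail s + cost_pd2 \<phi> (T, x T)"
  \<comment> \<open>The minus sign of \<open>\<gamma>1\<close> is absorbed by the one in
    \<open>right_RL_deriv\<close>.\<close>
  have eq: "\<gamma>2 * left_RL_int \<beta> a g s + - \<gamma>1 * right_RL_int \<alpha> T g s = ?k s" if "s \<in> {c..d}" for s
    using residual_eq_0[of s] that sub by (auto simp: residual_def)
  have k: "(?k has_real_derivative - p2 t - w) (at t within {c..d})"
  proof -
    have "continuous_on {a..T} p2"
      by (rule coefficients_continuous_subset) (use T_le in auto)
    then have "((\<lambda>s. integral {s..T} p2) has_real_derivative - p2 t) (at t within {c..d})"
      by (rule has_field_derivative_subset[OF tail_integral_derivative]) (use t sub in auto)
    from DERIV_add[OF DERIV_add[OF this delay_tail] DERIV_const] show ?thesis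
      by simp
  qed
  have "sum_splits \<gamma>2 (left_RL_int \<beta> a g) (- \<gamma>1) (right_RL_int \<alpha> T g) t {c..d}"
    using splits by (simp add: sum_splits_minus)
  note split_derivative[OF \<open>c < d\<close> t eq k this]
  then show "terms_differentiable \<gamma>2 (left_RL_int \<beta> a g) \<gamma>1 (right_RL_int \<alpha> T g) t {c..d}"
    and "p2 t + dual_RL_deriv {c..d} a T \<beta> \<alpha> \<gamma>2 \<gamma>1 g t + w = 0"
    by (simp_all add: terms_differentiable_minus dual_RL_deriv_def left_RL_deriv_def right_RL_deriv_def)
qed

lemma Euler_Lagrange_beyond:
  assumes "T < b" and t: "t \<in> {T..b}"
    and splits: "sum_splits \<gamma>2 (left_RL_int \<beta> a g) (- \<gamma>2) (left_RL_int \<beta> T g) t {T..b}"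
  shows "terms_differentiable \<gamma>2 (left_RL_int \<beta> a g) (- \<gamma>2) (left_RL_int \<beta> T g) t {T..b}"
    and "\<gamma>2 * (left_RL_deriv {T..b} \<beta> a g t - left_RL_deriv {T..b} \<beta> T g t) = 0"
proof -
  have eq: "\<gamma>2 * left_RL_int \<beta> a g s + - \<gamma>2 * left_RL_int \<beta> T g s = 0" if "s \<in> {T..b}" for s
    using outer_residual_eq_0[OF \<open>T < b\<close> that] by (simp add: outer_residual_def algebra_simps)
  note split_derivative[OF \<open>T < b\<close> t eq DERIV_const splits]
  then show "terms_differentiable \<gamma>2 (left_RL_int \<beta> a g) (- \<gamma>2) (left_RL_int \<beta> T g) t {T..b}"
    and "\<gamma>2 * (left_RL_deriv {T..b} \<beta> a g t - left_RL_deriv {T..b} \<beta> T g t) = 0"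
    by (simp_all add: left_RL_deriv_def algebra_simps)
qed

text \<open>At \<open>t = T\<close> the fractional integrals based at \<open>T\<close> are 0. The
  outer residual then gives \<open>\<gamma>2 * left_RL_int \<beta> a g T = 0\<close>, and of the
  inner residual only the cost term survives.\<close>

lemma terminal_state_condition: "cost_pd2 \<phi> (T, x T) = 0" if "T < b"
  using residual_eq_0[of T] outer_residual_eq_0[OF that, of T] delay_tail_eq_0[of T] aT \<sigma> that
  by (simp add: residual_def outer_residual_def right_RL_int_def left_RL_int_def[of \<beta> T])

lemma terminal_time_condition:
  assumes Tb: "T < b"
  shows "L (E T) + cost_pd1 \<phi> (T, x T) + cost_pd2 \<phi> (T, x T) * deriv x T = 0"
proof -
  define J where "J U = delay_functional a b \<alpha> \<beta> \<gamma>1 \<gamma>2 \<sigma> L \<phi> x U" for U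
  obtain x' where x': "\<And>t. t \<in> {a - \<sigma>..b} \<Longrightarrow> (x has_real_derivative x' t) (at t within {a - \<sigma>..b})"
    using x_C1 by blast
  have x'T: "(x has_real_derivative x' T) (at T)"
    using x'[of T] aT Tb \<sigma> by (simp add: at_within_Icc_at)
  have "((\<lambda>U. integral {a..U} (\<lambda>t. L (E t))) has_real_derivative L (E T)) (at T within {a..b})"
    by (rule integral_has_real_derivative[OF LE_continuous]) (use aT Tb in auto)
  then have int: "((\<lambda>U. integral {a..U} (\<lambda>t. L (E t))) has_real_derivative L (E T)) (at T)"
    using aT Tb by (simp add: at_within_Icc_at)
  \<comment> \<open>On the open strip, differentiability relative to the set is ordinary
    differentiability, and \<open>(T, x T)\<close> lies there because \<open>a < T\<close> and
    \<open>T < b\<close>.\<close>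
  have "\<phi> differentiable_on ({a<..<b} \<times> UNIV)"
    by (rule differentiable_on_subset[OF \<phi>_diff]) auto
  then have "\<phi> differentiable (at (T, x T))"
    using aT Tb by (subst (asm) differentiable_on_eq_differentiable_at) (auto intro!: open_Times)
  from DERIV_add[OF int terminal_cost_derivative_time[OF this x'T]]
  have J': "(J has_real_derivative L (E T) + (cost_pd1 \<phi> (T, x T) + cost_pd2 \<phi> (T, x T) * x' T)) (at T)"
    unfolding J_def[abs_def] delay_functional_def .
  obtain \<epsilon> where "0 < \<epsilon>"
    and \<epsilon>: "\<And>y U. (y, U) \<in> admissible a b \<alpha> \<beta> \<gamma>1 \<gamma>2 \<sigma> \<psi> \<Longrightarrow>
      delay_norm a b \<alpha> \<beta> \<gamma>1 \<gamma>2 \<sigma> (\<lambda>t. y t - x t, U - T) < \<epsilon> \<Longrightarrow>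
      delay_functional a b \<alpha> \<beta> \<gamma>1 \<gamma>2 \<sigma> L \<phi> x T \<le> delay_functional a b \<alpha> \<beta> \<gamma>1 \<gamma>2 \<sigma> L \<phi> y U"
    using minimal by blast
  have "J T \<le> J U" if "\<bar>T - U\<bar> < min \<epsilon> (min (T - a) (b - T))" for U
    unfolding J_def
  proof (rule \<epsilon>)
    show "(x, U) \<in> admissible a b \<alpha> \<beta> \<gamma>1 \<gamma>2 \<sigma> \<psi>"
      using x_admissible that by (auto simp: admissible_def delay_space_def)
    \<comment> \<open>The states do not differ, so the norm reduces to the distance of
      \<open>U\<close> from \<open>T\<close>.\<close>
    have "CD (\<lambda>t. 0) s = 0" if "s \<in> {a..b}" for s
      using combined_Caputo_derivative[of "\<lambda>t. 0" "\<lambda>t. 0" s] that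
      by (simp add: left_RL_int_def right_RL_int_def)
    then have "(SUP s\<in>{a..b}. \<bar>CD (\<lambda>t. 0) s\<bar>) = (SUP s\<in>{a..b}. 0)"
      by (intro SUP_cong) auto
    then show "delay_norm a b \<alpha> \<beta> \<gamma>1 \<gamma>2 \<sigma> (\<lambda>t. x t - x t, U - T) < \<epsilon>"
      using that ab_less \<sigma> by (simp add: delay_norm_def abs_minus_commute)
  qed
  then have "L (E T) + (cost_pd1 \<phi> (T, x T) + cost_pd2 \<phi> (T, x T) * x' T) = 0"
    using \<open>0 < \<epsilon>\<close> aT Tb by (intro DERIV_local_min[OF J', where d = "min \<epsilon> (min (T - a) (b - T))"]) auto
  then show ?thesis
    by (simp add: DERIV_imp_deriv[OF x'T])
qed

end

text \<open>The integral identities make only weighted sums differentiable; hence each equation is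
  stated wherever \<open>sum_splits\<close> holds, with existence of the weighted derivatives as
  part of the conclusion. For \<open>T < b\<close> the time \<open>T\<close> can be varied to both
  sides and \<open>{T..b}\<close> is nondegenerate.\<close>

theorem theorem50:
  fixes a b \<sigma> \<gamma>1 \<gamma>2 T :: real
    and \<alpha> \<beta> :: "real \<Rightarrow> real \<Rightarrow> real"
    and L :: "real \<times> real \<times> real \<times> real \<Rightarrow> real"
    and \<phi> :: "real \<times> real \<Rightarrow> real"
    and \<psi> x :: "real \<Rightarrow> real"
  assumes "a < b"
    and "continuous_on ({a..b} \<times> {a..b}) (\<lambda>(t, \<tau>). \<alpha> t \<tau>)"
    and "continuous_on ({a..b} \<times> {a..b}) (\<lambda>(t, \<tau>). \<beta> t \<tau>)"
    and "\<And>t \<tau>. t \<in> {a..b} \<Longrightarrow> \<tau> \<in> {a..b} \<Longrightarrow> \<alpha> t \<tau> \<in> {0<..<1}"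
    and "\<And>t \<tau>. t \<in> {a..b} \<Longrightarrow> \<tau> \<in> {a..b} \<Longrightarrow> \<beta> t \<tau> \<in> {0<..<1}"
    and "\<gamma>1 \<in> {0..1}" and "\<gamma>2 \<in> {0..1}" and "\<not> (\<gamma>1 = 0 \<and> \<gamma>2 = 0)"
    and "\<sigma> > 0"
    and "L differentiable_on ({a..b} \<times> UNIV)"
    and "continuous_on ({a..b} \<times> UNIV) (pd2 L)"
    and "continuous_on ({a..b} \<times> UNIV) (pd3 L)"
    and "continuous_on ({a..b} \<times> UNIV) (pd4 L)"
    and "\<phi> differentiable_on ({a..b} \<times> UNIV)"
    and "local_minimum a b \<alpha> \<beta> \<gamma>1 \<gamma>2 \<sigma> L \<phi> \<psi> x T"
    and "a < T"
  shows
    "let E = delay_args a b \<alpha> \<beta> \<gamma>1 \<gamma>2 \<sigma> x;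
         g = (\<lambda>t. pd3 L (E t));
         D = (\<lambda>S. dual_RL_deriv S a T \<beta> \<alpha> \<gamma>2 \<gamma>1 g);
         splits = (\<lambda>S t. sum_splits \<gamma>2 (left_RL_int \<beta> a g) \<gamma>1 (right_RL_int \<alpha> T g) t S);
         exists = (\<lambda>S t. terms_differentiable \<gamma>2 (left_RL_int \<beta> a g) \<gamma>1 (right_RL_int \<alpha> T g) t S)
     in
       (\<sigma> \<ge> T - a \<longrightarrow>
          (\<forall>t\<in>{a..T}. splits {a..T} t \<longrightarrow>
             exists {a..T} t \<and> pd2 L (E t) + D {a..T} t = 0)) \<and>
       (\<sigma> < T - a \<longrightarrow>
          (\<forall>t\<in>{a..T - \<sigma>}. splits {a..T - \<sigma>} t \<longrightarrow>
             exists {a..T - \<sigma>} t \<and> pd2 L (E t) + D {a..T - \<sigma>} t + pd4 L (E (t + \<sigma>)) = 0) \<and>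
          (\<forall>t\<in>{T - \<sigma>..T}. splits {T - \<sigma>..T} t \<longrightarrow>
             exists {T - \<sigma>..T} t \<and> pd2 L (E t) + D {T - \<sigma>..T} t = 0)) \<and>
       (T < b \<longrightarrow>
          (\<forall>t\<in>{T..b}.
             sum_splits \<gamma>2 (left_RL_int \<beta> a g) (- \<gamma>2) (left_RL_int \<beta> T g) t {T..b} \<longrightarrow>
             terms_differentiable \<gamma>2 (left_RL_int \<beta> a g) (- \<gamma>2) (left_RL_int \<beta> T g) t {T..b} \<and>
             \<gamma>2 * (left_RL_deriv {T..b} \<beta> a g t - left_RL_deriv {T..b} \<beta> T g t) = 0) \<and>
          L (E T) + cost_pd1 \<phi> (T, x T) + cost_pd2 \<phi> (T, x T) * deriv x T = 0 \<and>
          \<gamma>1 * right_RL_int \<alpha> T g T - \<gamma>2 * left_RL_int \<beta> T g T + cost_pd2 \<phi> (T, x T) = 0 \<and>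
          \<gamma>2 * (left_RL_int \<beta> T g b - left_RL_int \<beta> a g b) = 0)"
proof -
  interpret delay_minimizer a b \<alpha> \<beta> \<sigma> \<gamma>1 \<gamma>2 T L \<phi> \<psi> x
    using assms by unfold_locales auto
  \<comment> \<open>From \<open>T - \<sigma>\<close> on the tail is constantly 0, hence
    \<open>w = 0\<close>. The choice \<open>c = a\<close> serves the long delay,
    \<open>c = T - \<sigma>\<close> the last stretch of a short one.\<close>
  have long: "terms_differentiable \<gamma>2 (left_RL_int \<beta> a g) \<gamma>1 (right_RL_int \<alpha> T g) t {c..T}
      \<and> p2 t + dual_RL_deriv {c..T} a T \<beta> \<alpha> \<gamma>2 \<gamma>1 g t = 0"
    if "a \<le> c" "T - \<sigma> \<le> c" "c < T" "t \<in> {c..T}"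
      and splits: "sum_splits \<gamma>2 (left_RL_int \<beta> a g) \<gamma>1 (right_RL_int \<alpha> T g) t {c..T}" for c t
  proof -
    have "(delay_tail has_real_derivative - 0) (at t within {c..T})"
      by (rule has_field_derivative_transform_within[of "\<lambda>_. 0" _ _ _ 1])
         (use that in \<open>auto simp: delay_tail_eq_0\<close>)
    from Euler_Lagrange[OF \<open>c < T\<close> _ \<open>t \<in> {c..T}\<close> this splits] \<open>a \<le> c\<close> show ?thesis
      by auto
  qed
  have short: "terms_differentiable \<gamma>2 (left_RL_int \<beta> a g) \<gamma>1 (right_RL_int \<alpha> T g) t {a..T - \<sigma>}
      \<and> p2 t + dual_RL_deriv {a..T - \<sigma>} a T \<beta> \<alpha> \<gamma>2 \<gamma>1 g t + p4 (t + \<sigma>) = 0"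
    if "\<sigma> < T - a" and t: "t \<in> {a..T - \<sigma>}"
      and "sum_splits \<gamma>2 (left_RL_int \<beta> a g) \<gamma>1 (right_RL_int \<alpha> T g) t {a..T - \<sigma>}" for t
    using Euler_Lagrange[OF _ _ t delay_tail_derivative[OF t]] that \<sigma> by auto
  \<comment> \<open>These are integrals over a single point, so the second transversality condition
    reduces to \<open>cost_pd2 \<phi> (T, x T) = 0\<close>.\<close>
  have zero: "right_RL_int \<alpha> T g T = 0" "left_RL_int \<beta> T g T = 0"
    by (simp_all add: right_RL_int_def left_RL_int_def)
  have terminal: "\<gamma>2 * (left_RL_int \<beta> T g b - left_RL_int \<beta> a g b) = 0" if "T < b"
    using outer_residual_eq_0[of b] that by (auto simp: outer_residual_def)
  show ?thesis
    unfolding Let_def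
    using long[of a] short long[of "T - \<sigma>"] aT \<sigma> zero terminal Euler_Lagrange_beyond
      terminal_time_condition terminal_state_condition
    by auto
qed

end
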